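(* Let $X$ be an Asplund space, let $A,B\subset X$ be closed and let $\bar x\in A\cap B$. If the pair $\{A,B\}$ is extremal, then the following two equivalent conditions hold: (i) for any $\varepsilon>0$ there exist points $a\in A\cap\mathbb{B}_\varepsilon(\bar x)$, $b\in B\cap\mathbb{B}_\varepsilon(\bar x)$ and $a^*\in X^*$ such that $$\|a^*\|=1,\quad d(a^*,N_A(a))<\varepsilon\quad\text{and}\quad d(-a^*,N_B(b))<\varepsilon;$$ (ii) for any $\varepsilon>0$ there exist points $a\in A\cap\mathbb{B}_\varepsilon(\bar x)$, $b\in B\cap\mathbb{B}_\varepsilon(\bar x)$, $a^*\in N_A(a)$ and $b^*\in N_B(b)$ such that $$\|a^*\|+\|b^*\|=1\quad\text{and}\quad\|a^*+b^*\|<\varepsilon.$$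
   Context: A Banach space is Asplund if every continuous convex function defined on an open convex set $D$ is Fréchet differentiable at each point of some dense subset of $D$; equivalently, the dual of each of its separable subspaces is separable. $X^*$ is the topological dual of $X$ with the dual norm. $\mathbb{B}_\delta(x)$ is the open ball of radius $\delta$ centered at $x$, and $d(x^*,K)=\inf_{k\in K}\|x^*-k\|$. For $A\subset X$ and $a\in A$, the Fréchet normal cone to $A$ at $a$ is $$N_A(a)=\Big\{x^*\in X^*\;\Big|\;\limsup_{x\to a,\;x\in A\setminus\{a\}}\frac{\langle x^*,x-a\rangle}{\|x-a\|}\le0\Big\},$$ i.e. $x^*\in N_A(a)$ iff for every $\eta>0$ there is $\delta>0$ with $\langle x^*,x-a\rangle\le\eta\|x-a\|$ for all $x\in A\cap\mathbb{B}_\delta(a)$. For sets $A,B\subset X$ with $A\cap B\neq\emptyset$, the pair $\{A,B\}$ is extremal if for any $\varepsilon>0$ there exist $u,v\in X$ such that $(A-u)\cap(B-v)=\emptyset$ and $\max\{\|u\|,\|v\|\}<\varepsilon$. *)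

theory Defs
  imports "HOL-Analysis.Analysis"
begin

text \<open>The dual space \<open>X\<^sup>*\<close> is rendered as the type \<open>'a \<Rightarrow>\<^sub>L real\<close> of bounded linear functionals, whose
  norm is the operator norm.\<close>

text \<open>For a real normed space, \<open>f differentiable (at x)\<close> is Frechet differentiability at \<open>x\<close>.\<close>

definition asplund_space :: "'a::banach itself \<Rightarrow> bool" where
  "asplund_space _ \<longleftrightarrow>
    (\<forall>(D :: 'a set) (f :: 'a \<Rightarrow> real).
      open D \<and> convex D \<and> convex_on D f \<and> continuous_on D f \<longrightarrow>
      (\<exists>S. S \<subseteq> D \<and> D \<subseteq> closure S \<and> (\<forall>x\<in>S. f differentiable (at x))))"

text \<open>If \<open>a\<close> is isolated in \<open>A\<close>, the filter \<open>at a within A\<close> is trivial and the upper limit is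
  \<open>-\<infinity>\<close>, so that the cone is the whole dual space. The cone is only meant for \<open>a \<in> A\<close>.\<close>

definition frechet_normal_cone :: "'a::real_normed_vector set \<Rightarrow> 'a \<Rightarrow> ('a \<Rightarrow>\<^sub>L real) set" where
  "frechet_normal_cone A a =
    {x'. Limsup (at a within A) (\<lambda>x. ereal (blinfun_apply x' (x - a) / norm (x - a))) \<le> 0}"

lemma mem_frechet_normal_cone_iff:
  "x' \<in> frechet_normal_cone A a \<longleftrightarrow>
    (\<forall>\<eta>>0. \<exists>\<delta>>0. \<forall>x \<in> A \<inter> ball a \<delta>. blinfun_apply x' (x - a) \<le> \<eta> * norm (x - a))"
    (is "_ \<longleftrightarrow> ?R")
proof -
  let ?q = "\<lambda>x. blinfun_apply x' (x - a) / norm (x - a)"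
  have "x' \<in> frechet_normal_cone A a \<longleftrightarrow>
      (\<forall>y>0. eventually (\<lambda>x. ereal (?q x) < y) (at a within A))"
    by (simp add: frechet_normal_cone_def Limsup_le_iff)
  also have "\<dots> \<longleftrightarrow> ?R"
  proof
    assume L: "\<forall>y>0. eventually (\<lambda>x. ereal (?q x) < y) (at a within A)"
    show ?R
    proof (intro allI impI)
      fix \<eta> :: real assume "\<eta> > 0"
      then have "eventually (\<lambda>x. ?q x < \<eta>) (at a within A)"
        using L[rule_format, of "ereal \<eta>"] by simp
      then obtain \<delta> where \<delta>: "\<delta> > 0"
        "\<And>x. x \<in> A \<Longrightarrow> x \<noteq> a \<Longrightarrow> dist x a < \<delta> \<Longrightarrow> ?q x < \<eta>"
        by (auto simp: eventually_at)
      have "blinfun_apply x' (x - a) \<le> \<eta> * norm (x - a)" if "x \<in> A \<inter> ball a \<delta>" for x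
      proof (cases "x = a")
        case False
        then have "?q x < \<eta>" using that \<delta>(2) by (simp add: dist_commute)
        then show ?thesis using False by (simp add: divide_less_eq)
      qed (simp add: blinfun.zero_right)
      then show "\<exists>\<delta>>0. \<forall>x \<in> A \<inter> ball a \<delta>. blinfun_apply x' (x - a) \<le> \<eta> * norm (x - a)"
        using \<delta>(1) by blast
    qed
  next
    assume R: ?R
    show "\<forall>y>0. eventually (\<lambda>x. ereal (?q x) < y) (at a within A)"
    proof (intro allI impI)
      fix y :: ereal assume "y > 0"
      then obtain \<eta> where \<eta>: "0 < ereal \<eta>" "ereal \<eta> < y"
        using ereal_dense2 by blast
      then obtain \<delta> where \<delta>: "\<delta> > 0"
        "\<And>x. x \<in> A \<inter> ball a \<delta> \<Longrightarrow> blinfun_apply x' (x - a) \<le> \<eta> * norm (x - a)"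
        using R by (metis ereal_less(2))
      have "?q x \<le> \<eta>" if "x \<in> A" "x \<noteq> a" "dist x a < \<delta>" for x
        using \<delta>(2)[of x] that by (simp add: divide_le_eq dist_commute)
      then have "eventually (\<lambda>x. ?q x \<le> \<eta>) (at a within A)"
        using \<delta>(1) by (auto simp: eventually_at)
      then show "eventually (\<lambda>x. ereal (?q x) < y) (at a within A)"
        by eventually_elim (meson \<eta>(2) ereal_less_eq(3) le_less_trans)
    qed
  qed
  finally show ?thesis .
qed

definition extremal_pair :: "'a::real_normed_vector set \<Rightarrow> 'a set \<Rightarrow> bool" where
  "extremal_pair A B \<longleftrightarrow> A \<inter> B \<noteq> {} \<and>
    (\<forall>\<epsilon>>0. \<exists>u v. (\<lambda>x. x - u) ` A \<inter> (\<lambda>x. x - v) ` B = {} \<and> max (norm u) (norm v) < \<epsilon>)"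

text \<open>The library's \<open>infdist\<close> is 0 by convention for the empty set, but the cones below contain 0.\<close>

definition normal_distance_condition ::
  "'a::real_normed_vector set \<Rightarrow> 'a set \<Rightarrow> 'a \<Rightarrow> bool" where
  "normal_distance_condition A B \<xi> \<longleftrightarrow>
    (\<forall>\<epsilon>>0. \<exists>a \<in> A \<inter> ball \<xi> \<epsilon>. \<exists>b \<in> B \<inter> ball \<xi> \<epsilon>. \<exists>a' :: 'a \<Rightarrow>\<^sub>L real.
      norm a' = 1 \<and>
      infdist a' (frechet_normal_cone A a) < \<epsilon> \<and>
      infdist (- a') (frechet_normal_cone B b) < \<epsilon>)"

definition normal_sum_condition ::
  "'a::real_normed_vector set \<Rightarrow> 'a set \<Rightarrow> 'a \<Rightarrow> bool" where
  "normal_sum_condition A B \<xi> \<longleftrightarrow>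
    (\<forall>\<epsilon>>0. \<exists>a \<in> A \<inter> ball \<xi> \<epsilon>. \<exists>b \<in> B \<inter> ball \<xi> \<epsilon>.
      \<exists>a' \<in> frechet_normal_cone A a. \<exists>b' \<in> frechet_normal_cone B b.
      norm a' + norm b' = 1 \<and> norm (a' + b') < \<epsilon>)"

end

theory Submission
  imports Defs
begin

text \<open>A Frechet normal to the difference set \<open>A - B\<close> at \<open>a - b\<close> is normal to \<open>A\<close> at \<open>a\<close>, and its negative
  is normal to \<open>B\<close> at \<open>b\<close>. Extremality says that 0 is a limit of points \<open>y\<close> outside \<open>A - B\<close>.
  So the required normals are subgradients, at points near such a \<open>y\<close>, of a Lipschitz
  function on \<open>X\<close> that behaves like the distance to \<open>A - B\<close>; they do not vanish because such a
  function decreases at almost unit speed towards \<open>A - B\<close>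
  (\<open>extremal_pair_approx_normals\<close>).

  The Asplund property enters through one fact only, \<open>asplund_approx_subgradient\<close>: for every \<open>e > 0\<close>, a
  Lipschitz function \<open>f\<close> has, in every ball, a point with a Frechet subgradient up to an error
  \<open>e |k|\<close>. The convex function behind it is the maximal slope of \<open>f\<close> in the ball as a function
  of the direction. Its derivative at a direction \<open>h\<close> is an approximate subgradient of \<open>f\<close> wherever
  \<open>f\<close> ascends in direction \<open>h\<close> at almost maximal slope.

  The resulting normals are only approximate. Applying the same fact to the marginal function
  of a perturbed minimisation over the set improves the precision (\<open>approx_normal_refine\<close>), in such
  a way that the old precision persists on the old scale. Infinitely many improvements therefore
  converge to an exact normal (\<open>approx_normal_imp_near_frechet_normal\<close>). Infima that are not attained
  are handled by Ekeland's variational principle. The equivalence of the two conditions is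
  a matter of rescaling normals.\<close>

section \<open>Ekeland's variational principle\<close>

text \<open>Every point \<open>x\<close> dominates the closed set \<open>T x\<close> of points that lie below the downward cone of
  slope \<open>\<eta>\<close> with apex \<open>(x, g x)\<close>, and domination is transitive. Moving repeatedly to an almost
  minimal point of \<open>T x\<close> makes these sets shrink to a single point, which dominates only
  itself.\<close>

lemma ekeland_variational_principle:
  fixes g :: "'b::metric_space \<Rightarrow> real"
  assumes S: "complete S" and g: "continuous_on S g" and a: "a \<in> S"
    and \<eta>: "\<eta> > 0" and bound: "\<And>x. x \<in> S \<Longrightarrow> g a - \<eta> * l \<le> g x"
  obtains b where "b \<in> S" "dist b a \<le> l" "\<And>x. x \<in> S \<Longrightarrow> g b - \<eta> * dist x b \<le> g x"
proof -
  define T where "T x = {y \<in> S. g y + \<eta> * dist y x \<le> g x}" for x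
  have T_trans: "z \<in> T x" if "y \<in> T x" "z \<in> T y" for x y z
  proof -
    have "\<eta> * dist z x \<le> \<eta> * dist z y + \<eta> * dist y x"
      using \<eta> by (metis dist_triangle distrib_left mult_le_cancel_left_pos)
    then show ?thesis
      using that by (simp add: T_def)
  qed
  have T_self: "x \<in> T x" if "x \<in> S" for x
    using that by (simp add: T_def)
  have bdd: "bdd_below (g ` T x)" for x
    using bound by (intro bdd_belowI[of _ "g a - \<eta> * l"]) (auto simp: T_def)
  have "\<exists>y. y \<in> T x \<and> (\<forall>z \<in> T x. g y \<le> g z + (1/2) ^ n)" if "x \<in> S" for x n
  proof -
    have "\<exists>y \<in> g ` T x. y < Inf (g ` T x) + (1/2) ^ n"
      using T_self[OF that] by (intro cInf_lessD) auto
    then obtain y where "y \<in> T x" "g y < Inf (g ` T x) + (1/2) ^ n"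
      by blast
    moreover have "Inf (g ` T x) \<le> g z" if "z \<in> T x" for z
      using that bdd by (intro cInf_lower) auto
    ultimately show ?thesis
      by (metis add_le_cancel_right less_le_trans less_le)
  qed
  then have "\<exists>s. \<forall>n. (s n \<in> S \<and> (n = 0 \<longrightarrow> s n = a)) \<and>
      (s (Suc n) \<in> T (s n) \<and> (\<forall>z \<in> T (s n). g (s (Suc n)) \<le> g z + (1/2) ^ n))"
    using a by (intro dependent_nat_choice) (auto simp: T_def)
  then obtain s where sS: "\<And>n. s n \<in> S" and s0: "s 0 = a"
    and sT: "\<And>n. s (Suc n) \<in> T (s n)"
    and s_min: "\<And>n z. z \<in> T (s n) \<Longrightarrow> g (s (Suc n)) \<le> g z + (1/2) ^ n"
    by metis
  have later: "s n \<in> T (s m)" if "m \<le> n" for m n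
    using that by (induction rule: dec_induct) (auto intro: T_self sS T_trans sT)
  have small: "dist y (s (Suc n)) \<le> (1/2) ^ n / \<eta>" if "y \<in> T (s (Suc n))" for y n
  proof -
    have "y \<in> T (s n)"
      using that sT T_trans by blast
    then have "\<eta> * dist y (s (Suc n)) \<le> (1/2) ^ n"
      using s_min[of y n] that by (simp add: T_def)
    then show ?thesis
      using \<eta> by (simp add: field_simps)
  qed
  have lim0: "(\<lambda>n. (1/2) ^ n / \<eta>) \<longlonglongrightarrow> 0"
    by (intro tendsto_divide_zero LIMSEQ_power_zero) auto
  have "Cauchy s"
  proof (rule metric_CauchyI)
    fix e :: real assume "e > 0"
    then obtain n where n: "(1/2) ^ n / \<eta> < e / 2"
      using order_tendstoD(2)[OF lim0, of "e / 2"] by (auto simp: eventually_sequentially)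
    have "dist (s i) (s j) < e" if "i \<ge> Suc n" "j \<ge> Suc n" for i j
      using small[OF later[OF that(1)]] small[OF later[OF that(2)]] n
        dist_triangle2[of "s i" "s j" "s (Suc n)"] by linarith
    then show "\<exists>M. \<forall>m\<ge>M. \<forall>n\<ge>M. dist (s m) (s n) < e"
      by blast
  qed
  then obtain b where b: "b \<in> S" "s \<longlonglongrightarrow> b"
    using S sS by (auto simp: complete_def)
  have bT: "b \<in> T (s m)" for m
  proof -
    have "(\<lambda>n. g (s n) + \<eta> * dist (s n) (s m)) \<longlonglongrightarrow> g b + \<eta> * dist b (s m)"
      using g b sS by (intro tendsto_intros) (auto simp: continuous_on_sequentially o_def)
    then have "g b + \<eta> * dist b (s m) \<le> g (s m)"
      by (rule Lim_bounded[where M = m]) (use later in \<open>auto simp: T_def\<close>)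
    then show ?thesis
      using b by (simp add: T_def)
  qed
  show thesis
  proof
    show "b \<in> S" by fact
    have "\<eta> * dist b a \<le> \<eta> * l"
      using bT[of 0] bound[OF b(1)] by (simp add: T_def s0)
    then show "dist b a \<le> l"
      using \<eta> by simp
    fix x assume x: "x \<in> S"
    show "g b - \<eta> * dist x b \<le> g x"
    proof (rule ccontr)
      assume *: "\<not> ?thesis"
      then have "x \<in> T b"
        using x by (simp add: T_def)
      then have "dist x (s (Suc n)) \<le> (1/2) ^ n / \<eta>" for n
        using small bT T_trans by blast
      moreover have "(\<lambda>n. dist x (s (Suc n))) \<longlonglongrightarrow> dist x b"
        by (intro tendsto_intros LIMSEQ_Suc b)
      ultimately have "dist x b \<le> 0"
        using lim0 by (meson LIMSEQ_le)
      then show False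
        using * by simp
    qed
  qed
qed

section \<open>Approximate subgradients of Lipschitz functions\<close>

lemma lipschitz_on_INF:
  fixes \<phi> :: "'i \<Rightarrow> 'b::metric_space \<Rightarrow> real"
  assumes I: "I \<noteq> {}" and bdd: "\<And>z. bdd_below ((\<lambda>i. \<phi> i z) ` I)"
    and lip: "\<And>i. i \<in> I \<Longrightarrow> L-lipschitz_on UNIV (\<phi> i)" and "L \<ge> 0"
  shows "L-lipschitz_on UNIV (\<lambda>z. INF i\<in>I. \<phi> i z)"
proof -
  have *: "(INF i\<in>I. \<phi> i y) - L * dist x y \<le> (INF i\<in>I. \<phi> i x)" for x y
  proof (rule cINF_greatest[OF I])
    fix i assume i: "i \<in> I"
    have "(INF i\<in>I. \<phi> i y) \<le> \<phi> i y"
      by (rule cINF_lower[OF bdd i])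
    also have "\<dots> \<le> \<phi> i x + L * dist x y"
      using lipschitz_onD[OF lip[OF i], of x y] by (simp add: dist_real_def)
    finally show "(INF i\<in>I. \<phi> i y) - L * dist x y \<le> \<phi> i x"
      by simp
  qed
  show ?thesis
  proof (rule lipschitz_onI)
    fix x y
    show "dist (INF i\<in>I. \<phi> i x) (INF i\<in>I. \<phi> i y) \<le> L * dist x y"
      using *[of x y] *[of y x] by (simp add: dist_real_def dist_commute)
  qed fact
qed

text \<open>The supremum \<open>p\<close> of the slopes of \<open>f\<close> over all segments in \<open>U\<close> with direction \<open>h\<close> is, for open
  convex \<open>U\<close>, the support function of the Clarke subgradients of \<open>f\<close> at the points of \<open>U\<close>. It is the
  convex function to which the Asplund property is applied.\<close>

definition max_slope :: "('a::real_normed_vector \<Rightarrow> real) \<Rightarrow> 'a set \<Rightarrow> 'a \<Rightarrow> real" where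
  "max_slope f U h =
    Sup {(f (x + t *\<^sub>R h) - f x) / t |x t. t > 0 \<and> x \<in> U \<and> x + t *\<^sub>R h \<in> U}"

context
  fixes f :: "'a::real_normed_vector \<Rightarrow> real" and L :: real and c :: 'a and R :: real
  assumes lip: "L-lipschitz_on UNIV f" and R: "R > 0"
begin

private abbreviation (input) "U \<equiv> ball c R"
private abbreviation (input) "p \<equiv> max_slope f U"

lemma slope_le_norm: "(f (x + t *\<^sub>R h) - f x) / t \<le> L * norm h" if "t > 0"
proof -
  have "f (x + t *\<^sub>R h) - f x \<le> L * (t * norm h)"
    using lipschitz_onD[OF lip, of "x + t *\<^sub>R h" x] that by (simp add: dist_norm abs_le_iff)
  then show ?thesis
    using that by (simp add: pos_divide_le_eq mult_ac)
qed

lemma slope_le_max_slope: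
  assumes "t \<ge> 0" "x \<in> U" "x + t *\<^sub>R h \<in> U"
  shows "f (x + t *\<^sub>R h) - f x \<le> t * p h"
proof (cases "t = 0")
  case False
  have "(f (x + t *\<^sub>R h) - f x) / t \<le> p h"
    unfolding max_slope_def
  proof (rule cSup_upper)
    show "bdd_above {(f (x + t *\<^sub>R h) - f x) / t |x t. t > 0 \<and> x \<in> U \<and> x + t *\<^sub>R h \<in> U}"
      using slope_le_norm by (intro bdd_aboveI[of _ "L * norm h"]) auto
  qed (use False assms in force)
  then show ?thesis
    using False assms by (simp add: divide_le_eq mult.commute)
qed simp

text \<open>The supremum of the empty set of reals is unspecified, so admissible segments have to be exhibited
  before lower bounds of slopes mean anything.\<close>

lemma slope_set_nonempty: "\<exists>t>0. c + t *\<^sub>R h \<in> U"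
proof -
  define n where "n = norm h + 1"
  define t where "t = R / (2 * n)"
  have "n > 0"
    unfolding n_def using norm_ge_zero[of h] by linarith
  then have t: "t > 0" and "t * n = R / 2"
    using R by (simp_all add: t_def)
  then have "t * norm h < R"
    using R by (simp add: n_def algebra_simps)
  then have "c + t *\<^sub>R h \<in> U"
    using t by (simp add: dist_norm)
  then show ?thesis
    using t by blast
qed

lemma max_slope_least:
  assumes "\<And>x t. t > 0 \<Longrightarrow> x \<in> U \<Longrightarrow> x + t *\<^sub>R h \<in> U \<Longrightarrow> f (x + t *\<^sub>R h) - f x \<le> t * q"
  shows "p h \<le> q"
  unfolding max_slope_def
proof (rule cSup_least)
  show "{(f (x + t *\<^sub>R h) - f x) / t |x t. t > 0 \<and> x \<in> U \<and> x + t *\<^sub>R h \<in> U} \<noteq> {}"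
    using slope_set_nonempty[of h] R by (auto intro!: exI[of _ c])
qed (use assms in \<open>auto simp: divide_le_eq mult.commute\<close>)

lemma max_slope_approx:
  assumes "\<alpha> > 0"
  obtains x t where "t > 0" "x \<in> U" "x + t *\<^sub>R h \<in> U" "t * (p h - \<alpha>) < f (x + t *\<^sub>R h) - f x"
proof (rule ccontr)
  assume "\<not> thesis"
  then have "p h \<le> p h - \<alpha>"
    using that by (intro max_slope_least) (meson not_le)
  then show False
    using assms by simp
qed

lemma max_slope_le_norm: "p h \<le> L * norm h"
proof (rule max_slope_least)
  fix x t assume "t > (0::real)"
  then show "f (x + t *\<^sub>R h) - f x \<le> t * (L * norm h)"
    using slope_le_norm[of t x h] by (simp add: divide_le_eq mult_ac)
qed

lemma max_slope_scaleR_le: "p (s *\<^sub>R h) \<le> s * p h" if "s > 0"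
proof (rule max_slope_least)
  fix x t assume "t > (0::real)" "x \<in> U" "x + t *\<^sub>R s *\<^sub>R h \<in> U"
  then show "f (x + t *\<^sub>R s *\<^sub>R h) - f x \<le> t * (s * p h)"
    using slope_le_max_slope[of "t * s" x h] that by simp
qed

text \<open>A step along \<open>h + k\<close> is a step along \<open>h\<close> followed by one along \<open>k\<close>, but the intermediate point may
  leave the ball. The segment is therefore cut into pieces so short that the detours stay inside,
  and the increments of \<open>f\<close> over the pieces are added up.\<close>

lemma max_slope_add_le: "p (h + k) \<le> p h + p k"
proof (rule max_slope_least)
  fix x t assume t: "t > (0::real)" and x: "x \<in> U" and y: "x + t *\<^sub>R (h + k) \<in> U"
  \<comment> \<open>The segment lies in the closed ball of radius \<open>m\<close>, so detours shorter than \<open>R - m\<close> are harmless.\<close>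
  define m where "m = max (dist c x) (dist c (x + t *\<^sub>R (h + k)))"
  have m: "m < R"
    using x y by (simp add: m_def)
  obtain N :: nat where N: "t * norm h / (R - m) < N"
    using reals_Archimedean2 by blast
  have "t * norm h / (R - m) \<ge> 0"
    using t m by simp
  then have N0: "real N > 0"
    using N by linarith
  define d where "d = t / N"
  have d: "d > 0" "d * norm h < R - m"
    using N N0 t m by (simp_all add: d_def field_simps)
  define y where "y j = x + (real j * d) *\<^sub>R (h + k)" for j :: nat
  have yin: "dist c (y j) \<le> m" if "j \<le> N" for j
  proof -
    define s where "s = real j / N"
    have s: "0 \<le> s" "s \<le> 1"
      using that N0 by (simp_all add: s_def)
    have "y j = (1 - s) *\<^sub>R x + s *\<^sub>R (x + t *\<^sub>R (h + k))"
      by (simp add: y_def s_def d_def algebra_simps)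
    moreover have "convex (cball c m)" by simp
    ultimately have "y j \<in> cball c m"
      using s unfolding convex_alt by (simp add: m_def)
    then show ?thesis by simp
  qed
  have "f (y j) - f x \<le> real j * d * (p h + p k)" if "j \<le> N" for j
    using that
  proof (induction j)
    case (Suc j)
    have "dist c (y j + d *\<^sub>R h) \<le> dist c (y j) + d * norm h"
      using dist_triangle[of c "y j + d *\<^sub>R h" "y j"] d by (simp add: dist_norm)
    then have mid: "y j + d *\<^sub>R h \<in> U"
      using yin[of j] Suc.prems d by simp
    have step: "y (Suc j) = (y j + d *\<^sub>R h) + d *\<^sub>R k"
      by (simp add: y_def algebra_simps)
    have "f (y j + d *\<^sub>R h) - f (y j) \<le> d * p h"
      using yin[of j] Suc.prems m d mid by (intro slope_le_max_slope) auto
    moreover have "f (y (Suc j)) - f (y j + d *\<^sub>R h) \<le> d * p k"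
      using slope_le_max_slope[of d "y j + d *\<^sub>R h" k] yin[of "Suc j"] Suc.prems m d mid
      unfolding step by auto
    ultimately show ?case
      using Suc by (simp add: algebra_simps)
  qed (simp add: y_def)
  from this[of N] show "f (x + t *\<^sub>R (h + k)) - f x \<le> t * (p h + p k)"
    using N0 by (simp add: y_def d_def)
qed

lemma convex_on_max_slope: "convex_on UNIV p"
proof (rule convex_onI)
  fix t :: real and x y :: 'a
  assume t: "0 < t" "t < 1"
  have "p ((1 - t) *\<^sub>R x + t *\<^sub>R y) \<le> p ((1 - t) *\<^sub>R x) + p (t *\<^sub>R y)"
    by (rule max_slope_add_le)
  also have "\<dots> \<le> (1 - t) * p x + t * p y"
    using t by (intro add_mono max_slope_scaleR_le) auto
  finally show "p ((1 - t) *\<^sub>R x + t *\<^sub>R y) \<le> (1 - t) * p x + t * p y" .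
qed simp

lemma lipschitz_max_slope: "L-lipschitz_on UNIV p"
proof (rule lipschitz_onI)
  show "L \<ge> 0"
    using lip by (simp add: lipschitz_on_def)
  fix x y
  have "p x \<le> p y + L * norm (x - y)" for x y
    using max_slope_add_le[of y "x - y"] max_slope_le_norm[of "x - y"] by simp
  from this[of x y] this[of y x] show "dist (p x) (p y) \<le> L * dist x y"
    by (simp add: dist_norm abs_le_iff norm_minus_commute)
qed

end

text \<open>Let \<open>p\<close> be the maximal slope of \<open>f\<close> on the ball, \<open>h\<close> a point where \<open>p\<close> is Frechet
  differentiable, and \<open>D\<close> its derivative there. Choose a segment in direction \<open>h\<close> on which \<open>f\<close>
  has a slope above \<open>p h - \<alpha>\<close>. Subtracting that slope and minimising along the segment yields a point \<open>z\<close> with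
  \<open>f z \<le> f (z + r h) - r (p h - \<alpha>)\<close> for all small \<open>r > 0\<close>. Going from \<open>z + k\<close> to \<open>z + r h\<close> gains
  at most \<open>p (r h - k) = r p (h - k / r)\<close>, which by differentiability is about \<open>r p h - D k\<close> as
  soon as \<open>r\<close> is a large multiple of the norm of \<open>k\<close>. The terms \<open>r p h\<close> cancel, and
  \<open>f z \<le> f (z + k) - D k\<close> remains up to the loss \<open>\<alpha> r\<close> and the error of differentiation, both at
  most small multiples of the norm of \<open>k\<close>: \<open>D\<close> is an approximate subgradient of \<open>f\<close> at \<open>z\<close>.\<close>

lemma asplund_approx_subgradient:
  fixes f :: "'a::banach \<Rightarrow> real"
  assumes asplund: "asplund_space TYPE('a)" and lip: "L-lipschitz_on UNIV f"
    and R: "R > 0" and e: "e > 0"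
  obtains z z' d where "z \<in> ball c R" "d > 0" "norm z' \<le> L + e"
    "\<And>k. norm k \<le> d \<Longrightarrow> f z + blinfun_apply z' k - e * norm k \<le> f (z + k)"
proof -
  let ?p = "max_slope f (ball c R)"
  have "continuous_on UNIV ?p"
    using lipschitz_max_slope[OF lip R] lipschitz_on_continuous_on by blast
  then have "\<exists>S. UNIV \<subseteq> closure S \<and> (\<forall>x\<in>S. ?p differentiable (at x))"
    using asplund convex_on_max_slope[OF lip R] unfolding asplund_space_def
    by (metis convex_UNIV open_UNIV)
  then obtain S h where "h \<in> S" "\<forall>x\<in>S. ?p differentiable (at x)"
    by (metis UNIV_not_empty closure_empty ex_in_conv subset_empty)
  then obtain D where D: "(?p has_derivative D) (at h)"
    by (auto simp: differentiable_def)
  define z' where "z' = Blinfun D"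
  have z'[simp]: "blinfun_apply z' = D"
    using D has_derivative_bounded_linear by (auto simp: z'_def bounded_linear_Blinfun_apply)
  obtain \<rho> where \<rho>: "\<rho> > 0"
    "\<And>k. norm k < \<rho> \<Longrightarrow> norm (?p (h + k) - ?p h - D k) \<le> e / 2 * norm k"
  proof -
    have "\<exists>\<rho>>0. \<forall>y. norm (y - h) < \<rho> \<longrightarrow> norm (?p y - ?p h - D (y - h)) \<le> e / 2 * norm (y - h)"
      using D e unfolding has_derivative_at_alt by (metis half_gt_zero)
    then obtain \<rho> where "\<rho> > 0"
      "\<And>y. norm (y - h) < \<rho> \<Longrightarrow> norm (?p y - ?p h - D (y - h)) \<le> e / 2 * norm (y - h)"
      by blast
    from this(1) this(2)[of "h + _"] show thesis
      by (auto intro: that)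
  qed
  \<comment> \<open>Below, \<open>r = 2 |k| / \<rho>\<close> is used for the increment \<open>k\<close>; then the loss \<open>\<alpha> r\<close> is half of \<open>e |k|\<close>.\<close>
  define \<alpha> where "\<alpha> = e * \<rho> / 4"
  have \<alpha>: "\<alpha> > 0"
    using e \<rho> by (simp add: \<alpha>_def)
  obtain x1 t1 where x1: "t1 > 0" "x1 \<in> ball c R" "x1 + t1 *\<^sub>R h \<in> ball c R"
    and slope: "t1 * (?p h - \<alpha>) < f (x1 + t1 *\<^sub>R h) - f x1"
    using max_slope_approx[OF lip R \<alpha>] by blast
  define \<phi> where "\<phi> t = f (x1 + t *\<^sub>R h) - t * (?p h - \<alpha>)" for t
  have "continuous_on UNIV f"
    using lip lipschitz_on_continuous_on by blast
  then have "continuous_on {0..t1} (\<lambda>t. f (x1 + t *\<^sub>R h))"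
    by (rule continuous_on_compose2) (intro continuous_intros, simp)
  then have "continuous_on {0..t1} \<phi>"
    unfolding \<phi>_def by (intro continuous_intros)
  then obtain t0 where t0: "t0 \<in> {0..t1}" "\<And>t. t \<in> {0..t1} \<Longrightarrow> \<phi> t0 \<le> \<phi> t"
    using continuous_attains_inf[of "{0..t1}" \<phi>] x1 by auto
  have "\<phi> t0 \<le> \<phi> 0" "\<phi> 0 < \<phi> t1"
    using t0(2)[of 0] x1 slope by (auto simp: \<phi>_def)
  \<comment> \<open>The minimiser is not the right end point, so there is room to move on in direction \<open>h\<close>.\<close>
  then have "t0 < t1"
    using t0(1) by (cases "t0 = t1") auto
  have in_ball: "x1 + t *\<^sub>R h \<in> ball c R" if "t \<in> {0..t1}" for t
  proof -
    have "x1 + t *\<^sub>R h = (1 - t / t1) *\<^sub>R x1 + (t / t1) *\<^sub>R (x1 + t1 *\<^sub>R h)"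
      using x1(1) by (simp add: algebra_simps)
    then show ?thesis
      using convex_ball[of c R] x1 that unfolding convex_alt by (metis atLeastAtMost_iff
          divide_le_eq_1_pos divide_nonneg_pos)
  qed
  define z where "z = x1 + t0 *\<^sub>R h"
  have z: "z \<in> ball c R"
    using in_ball t0 by (simp add: z_def)
  obtain d1 where d1: "d1 > 0" "ball z d1 \<subseteq> ball c R"
    using z open_ball open_contains_ball by blast
  define d where "d = min (d1 / 2) (\<rho> * (t1 - t0) / 2)"
  have d: "d > 0"
    using d1 \<rho> \<open>t0 < t1\<close> by (simp add: d_def)
  have sub: "f z + D k - e * norm k \<le> f (z + k)" if k: "norm k \<le> d" for k
  proof (cases "k = 0")
    case True
    then show ?thesis
      using D by (simp add: has_derivative_bounded_linear linear_simps)
  next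
    case False
    define r where "r = 2 * norm k / \<rho>"
    have r: "r > 0" "r \<le> t1 - t0" "norm k = r * \<rho> / 2"
      using False \<rho> k by (auto simp: r_def d_def field_simps)
    define q where "q = - (1 / r) *\<^sub>R k"
    have q: "norm q = \<rho> / 2"
      using r \<rho> by (simp add: q_def)
    have "norm k < d1"
      using k d1 by (simp add: d_def)
    then have "z + k \<in> ball z d1"
      by (simp add: dist_norm)
    then have zk: "z + k \<in> ball c R"
      using d1 by blast
    have eq: "x1 + (t0 + r) *\<^sub>R h = z + r *\<^sub>R h"
      by (simp add: z_def algebra_simps)
    have zr: "z + r *\<^sub>R h \<in> ball c R"
      using in_ball[of "t0 + r"] r t0 unfolding eq by auto
    have "\<phi> t0 \<le> \<phi> (t0 + r)"
      using r t0 by auto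
    then have "f z \<le> f (z + r *\<^sub>R h) - r * (?p h - \<alpha>)"
      unfolding \<phi>_def eq by (simp add: z_def[symmetric] algebra_simps)
    moreover have "f (z + r *\<^sub>R h) \<le> f (z + k) + ?p (r *\<^sub>R h - k)"
      using slope_le_max_slope[OF lip R, where c = c and t = 1 and x = "z + k" and h = "r *\<^sub>R h - k"]
        zk zr by simp
    moreover have "?p (r *\<^sub>R h - k) \<le> r * (?p h - D k / r + e * \<rho> / 4)"
    proof -
      have "?p (r *\<^sub>R h - k) = ?p (r *\<^sub>R (h + q))"
        using r by (simp add: q_def algebra_simps)
      also have "\<dots> \<le> r * ?p (h + q)"
        using r by (intro max_slope_scaleR_le[OF lip R]) auto
      also have "?p (h + q) - ?p h - D q \<le> e * \<rho> / 4"
        using \<rho>(2)[of q] \<rho>(1) q abs_ge_self[of "?p (h + q) - ?p h - D q"] by simp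
      then have "?p (h + q) \<le> ?p h - D k / r + e * \<rho> / 4"
        using has_derivative_bounded_linear[OF D] by (simp add: q_def linear_simps)
      then have "r * ?p (h + q) \<le> r * (?p h - D k / r + e * \<rho> / 4)"
        using r by (intro mult_left_mono) auto
      finally show ?thesis .
    qed
    ultimately have "f z \<le> f (z + k) + r * (?p h - D k / r + e * \<rho> / 4) - r * (?p h - \<alpha>)"
      by linarith
    moreover have "r * (?p h - D k / r + e * \<rho> / 4) - r * (?p h - \<alpha>) = e * (r * \<rho> / 2) - D k"
      using r(1) by (simp add: \<alpha>_def algebra_simps)
    ultimately show ?thesis
      unfolding r(3) by linarith
  qed
  \<comment> \<open>The growth of \<open>f\<close> is at most \<open>L\<close> times the distance, and any \<open>k\<close> can be scaled to length \<open>d\<close>.\<close>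
  have "norm z' \<le> L + e"
  proof (rule norm_blinfun_bound)
    show L: "0 \<le> L + e"
      using lip e by (simp add: lipschitz_on_def)
    fix k :: 'a
    show "norm (blinfun_apply z' k) \<le> (L + e) * norm k"
    proof (cases "k = 0")
      case False
      have "D k \<le> (L + e) * norm k" if "k \<noteq> 0" for k
      proof -
        define s where "s = d / norm k"
        have s: "s > 0" "norm (s *\<^sub>R k) = d"
          using d that by (simp_all add: s_def)
        have "f (z + s *\<^sub>R k) - f z \<le> L * norm (s *\<^sub>R k)"
          using lipschitz_onD[OF lip, of "z + s *\<^sub>R k" z] by (simp add: dist_norm)
        then have "D (s *\<^sub>R k) \<le> (L + e) * norm (s *\<^sub>R k)"
          using sub[of "s *\<^sub>R k"] s by (simp add: algebra_simps)
        then have "s * D k \<le> s * ((L + e) * norm k)"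
          using s has_derivative_bounded_linear[OF D] by (simp add: linear_simps)
        then show ?thesis
          using s by simp
      qed
      from this[of k] this[of "- k"] show ?thesis
        using False has_derivative_bounded_linear[OF D] by (simp add: linear_simps abs_le_iff)
    qed (use has_derivative_bounded_linear[OF D] in \<open>simp add: linear_simps\<close>)
  qed
  then show thesis
    using that[OF z d, of z'] sub by simp
qed

section \<open>From approximate to exact Frechet normals\<close>

definition approx_normal :: "'a::real_normed_vector set \<Rightarrow> 'a \<Rightarrow> real \<Rightarrow> real \<Rightarrow> ('a \<Rightarrow>\<^sub>L real) \<Rightarrow> bool" where
  "approx_normal A a r e w \<longleftrightarrow> (\<forall>x\<in>A. norm (x - a) \<le> r \<longrightarrow> blinfun_apply w (x - a) \<le> e * norm (x - a))"

lemma approx_normalD: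
  "approx_normal A a r e w \<Longrightarrow> x \<in> A \<Longrightarrow> norm (x - a) \<le> r \<Longrightarrow> blinfun_apply w (x - a) \<le> e * norm (x - a)"
  by (simp add: approx_normal_def)

lemma approx_normal_mono:
  "approx_normal A a r e w \<Longrightarrow> r' \<le> r \<Longrightarrow> e \<le> e' \<Longrightarrow> approx_normal A a r' e' w"
  unfolding approx_normal_def
  by (meson mult_right_mono norm_ge_zero order_trans)

text \<open>An approximate normal \<open>w\<close> of precision \<open>e\<close> is improved to an arbitrary precision \<open>e'\<close>, close to the
  old base point and functional. What makes the improvement repeatable is the penultimate
  conclusion: on half the old radius, the new functional still has precision of order \<open>e\<close> with
  respect to the new base point. Without it the radii of successive improvements would be unrelated,
  and nothing would survive in the limit.

  By assumption \<open>2 e |x - a| - w (x - a)\<close> has a strict local minimum over \<open>A\<close> at \<open>a\<close>. Moving the kink \<open>a\<close> to \<open>z\<close>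
  and minimising gives a Lipschitz function \<open>G\<close> of \<open>z\<close>; let \<open>z'\<close> be an approximate subgradient
  of \<open>G\<close> at some \<open>z\<close> near \<open>a\<close>, and \<open>x\<close> an approximate minimiser for \<open>z\<close>. Shifting \<open>z\<close> together with \<open>x\<close>
  does not change the kink term, so lower bounds of \<open>G\<close> around \<open>z\<close> become lower bounds of \<open>- w\<close> on
  \<open>A\<close> around \<open>x\<close>: locally of slope \<open>z'\<close>, and everywhere with the Lipschitz constant of \<open>G\<close>.
  Ekeland's principle removes the additive error of \<open>x\<close>, and \<open>w + z'\<close> is the new functional.\<close>

lemma approx_normal_refine:
  fixes A :: "'a::banach set"
  assumes asplund: "asplund_space TYPE('a)" and A: "closed A" and a: "a \<in> A"
    and normal: "approx_normal A a r e w" and e: "e > 0" and r: "r > 0"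
    and e': "0 < e'" "e' \<le> e" and l: "l > 0"
  obtains b v s where "b \<in> A" "dist b a \<le> l" "norm (v - w) \<le> 3 * e" "s > 0"
    "approx_normal A b (r / 2) (8 * e) v" "approx_normal A b s e' v"
proof -
  \<comment> \<open>Only the part of \<open>A\<close> where \<open>w\<close> is controlled enters the minimisation.\<close>
  define C where "C = A \<inter> cball a r"
  have C: "complete C" "a \<in> C"
    using A a r by (simp_all add: C_def complete_eq_closed closed_Int)
  define \<phi> where "\<phi> x z = 2 * e * norm (x - z) - w (x - a)" for x z
  define G where "G z = (INF x\<in>C. \<phi> x z)" for z
  have w_le: "w (x - a) \<le> e * norm (x - a)" "norm (x - a) \<le> r" if "x \<in> C" for x
    using normal that by (auto simp: C_def approx_normal_def dist_norm norm_minus_commute)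
  have \<phi>_ge: "- (e * r) \<le> \<phi> x z" if "x \<in> C" for x z
  proof -
    have "e * norm (x - a) \<le> e * r"
      using w_le(2)[OF that] e by simp
    moreover have "0 \<le> 2 * e * norm (x - z)"
      using e by simp
    ultimately show ?thesis
      using w_le(1)[OF that] unfolding \<phi>_def by linarith
  qed
  have bdd: "bdd_below ((\<lambda>x. \<phi> x z) ` C)" for z
    using \<phi>_ge by (intro bdd_belowI[of _ "- (e * r)"]) auto
  have G_lip: "(2 * e)-lipschitz_on UNIV G"
    unfolding G_def
  proof (rule lipschitz_on_INF)
    fix x
    show "(2 * e)-lipschitz_on UNIV (\<phi> x)"
    proof (rule lipschitz_onI)
      fix y z
      have "\<bar>norm (x - y) - norm (x - z)\<bar> \<le> norm (y - z)"
        using norm_triangle_ineq3[of "x - y" "x - z"] by (simp add: norm_minus_commute)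
      then have "2 * e * \<bar>norm (x - y) - norm (x - z)\<bar> \<le> 2 * e * norm (y - z)"
        using e by (intro mult_left_mono) auto
      then show "dist (\<phi> x y) (\<phi> x z) \<le> 2 * e * dist y z"
        using e by (simp add: \<phi>_def dist_norm right_diff_distrib[symmetric] abs_mult)
    qed (use e in simp)
  qed (use bdd C e in auto)
  define m where "m = min (l / 2) (r / 4)"
  have m: "m > 0" "m \<le> l / 2" "m \<le> r / 4"
    using l r by (auto simp: m_def)
  obtain z z' d where z: "z \<in> ball a (m / 8)" and d: "d > 0" and z': "norm z' \<le> 2 * e + e' / 2"
    and sub: "\<And>k. norm k \<le> d \<Longrightarrow> G z + blinfun_apply z' k - e' / 2 * norm k \<le> G (z + k)"
    using asplund_approx_subgradient[OF asplund G_lip, of "m / 8" "e' / 2" a] m e' half_gt_zero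
    by (metis zero_less_divide_iff zero_less_numeral)
  have z'_le: "z' k \<le> 3 * e * norm k" for k
  proof -
    have "z' k \<le> norm z' * norm k"
      using norm_blinfun[of z' k] by simp
    also have "\<dots> \<le> 3 * e * norm k"
      using z' e' by (intro mult_right_mono) auto
    finally show ?thesis .
  qed
  define \<eta> where "\<eta> = min (min (d / 2) (e' / 2)) (min (m / 2) 1)"
  have \<eta>: "\<eta> > 0" "\<eta> \<le> d / 2" "\<eta> \<le> e' / 2" "\<eta> \<le> m / 2"
    using d e' m by (auto simp: \<eta>_def)
  have "\<exists>y \<in> (\<lambda>x. \<phi> x z) ` C. y < G z + \<eta> * \<eta>"
    unfolding G_def using C \<eta> by (intro cInf_lessD) auto
  then obtain x where x: "x \<in> C" and x_min: "\<phi> x z < G z + \<eta> * \<eta>"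
    by blast
  have x_near: "norm (x - a) \<le> m"
  proof -
    have "G z \<le> \<phi> a z"
      unfolding G_def by (rule cINF_lower[OF bdd C(2)])
    then have "\<phi> x z \<le> 2 * e * norm (a - z) + \<eta> * \<eta>"
      using x_min by (simp add: \<phi>_def)
    moreover have "2 * e * norm (x - a) \<le> 2 * e * (norm (x - z) + norm (a - z))"
      using norm_triangle_ineq4[of "x - z" "a - z"] e by (intro mult_left_mono) auto
    ultimately have "e * norm (x - a) \<le> 4 * e * norm (a - z) + \<eta> * \<eta>"
      using w_le(1)[OF x] unfolding \<phi>_def by (simp add: algebra_simps)
    also have "\<dots> \<le> 4 * e * (m / 8) + e / 2 * (m / 2)"
      using z \<eta> e e' by (intro add_mono mult_left_mono mult_mono) (auto simp: dist_norm)
    also have "\<dots> \<le> e * m"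
      using e m by (simp add: field_simps)
    finally show ?thesis
      using e by simp
  qed
  \<comment> \<open>\<open>M\<close> combines the local and the global lower bound of \<open>G (z + k) - G z\<close>. The slope \<open>5 e\<close> beyond
    radius \<open>d\<close> accounts for \<open>2 e\<close> from \<open>G\<close> and \<open>3 e\<close> from \<open>z'\<close>.\<close>
  define M where "M k = z' k - e' / 2 * norm k - 5 * e * max 0 (norm k - d)" for k
  have M_le: "G z + M k \<le> G (z + k)" for k
  proof (cases "norm k \<le> d")
    case True
    then show ?thesis
      using sub[of k] by (simp add: M_def)
  next
    case False
    define q where "q = (d / norm k) *\<^sub>R k"
    have q: "norm q = d" "norm (k - q) = norm k - d"
    proof -
      show "norm q = d"
        using False d by (auto simp: q_def)
      have k: "norm k > 0" "d / norm k \<le> 1"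
        using False d by (auto simp: divide_le_eq_1)
      have "k - q = (1 - d / norm k) *\<^sub>R k"
        by (simp add: q_def algebra_simps)
      then have "norm (k - q) = \<bar>1 - d / norm k\<bar> * norm k"
        by simp
      also have "\<dots> = norm k - d"
        using k by (simp add: left_diff_distrib)
      finally show "norm (k - q) = norm k - d" .
    qed
    have "G (z + q) - G (z + k) \<le> 2 * e * norm (k - q)"
      using lipschitz_onD[OF G_lip, of "z + q" "z + k"] by (simp add: dist_norm norm_minus_commute)
    moreover have "z' k \<le> z' q + 3 * e * norm (k - q)"
      using z'_le[of "k - q"] by (simp add: blinfun.diff_right)
    moreover have "G z + z' q - e' / 2 * d \<le> G (z + q)"
      using sub[of q] q by simp
    moreover have "e' / 2 * d \<le> e' / 2 * norm k"
      using False e' by simp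
    moreover have "max 0 (norm k - d) = norm k - d"
      using False by simp
    ultimately show ?thesis
      unfolding M_def q(2) by (simp add: algebra_simps)
  qed
  define g where "g y = - w (y - a) - M (y - x)" for y
  have "continuous_on C g"
    unfolding g_def M_def by (intro continuous_intros)
  moreover have "g x - \<eta> * \<eta> \<le> g y" if "y \<in> C" for y
  proof -
    have "G z + M (y - x) \<le> G (z + (y - x))"
      by (rule M_le)
    also have "\<dots> \<le> \<phi> y (z + (y - x))"
      unfolding G_def by (rule cINF_lower[OF bdd that])
    finally show ?thesis
      using x_min d by (simp add: g_def \<phi>_def M_def algebra_simps)
  qed
  ultimately obtain b where b: "b \<in> C" "dist b x \<le> \<eta>"
    and b_min: "\<And>y. y \<in> C \<Longrightarrow> g b - \<eta> * dist y b \<le> g y"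
    using ekeland_variational_principle[OF C(1) _ x \<eta>(1), of g \<eta>] by blast
  define v where "v = w + z'"
  have v_le: "v (y - b) \<le> \<eta> * norm (y - b) + e' / 2 * norm (y - b)
      + 5 * e * (max 0 (norm (y - x) - d) - max 0 (norm (b - x) - d))" if "y \<in> C" for y
  proof -
    have "norm (y - x) - norm (b - x) \<le> norm (y - b)"
      using norm_triangle_ineq2[of "y - x" "b - x"] by simp
    then have "e' / 2 * (norm (y - x) - norm (b - x)) \<le> e' / 2 * norm (y - b)"
      using e' by (intro mult_left_mono) auto
    then show ?thesis
      using b_min[OF that] unfolding g_def M_def v_def
      by (simp add: blinfun.diff_right blinfun.add_left dist_norm algebra_simps)
  qed
  have b_near: "dist b a \<le> r / 2" "dist b a \<le> l"
    using b(2) x_near \<eta>(4) m norm_triangle_ineq[of "b - x" "x - a"] by (auto simp: dist_norm)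
  have in_C: "y \<in> C" if "y \<in> A" "norm (y - b) \<le> r / 2" for y
    using that b_near dist_triangle[of a y b] by (auto simp: C_def dist_commute dist_norm[of y b, symmetric])
  show thesis
  proof (rule that[of b v "min (d / 2) (r / 2)"])
    show "b \<in> A" "dist b a \<le> l" "min (d / 2) (r / 2) > 0"
      using b b_near d r by (auto simp: C_def)
    show "norm (v - w) \<le> 3 * e"
      using z' e' by (simp add: v_def)
    show "approx_normal A b (r / 2) (8 * e) v"
      unfolding approx_normal_def
    proof (intro ballI impI)
      fix y assume y: "y \<in> A" "norm (y - b) \<le> r / 2"
      have "norm (y - x) \<le> norm (y - b) + norm (b - x)" "0 \<le> norm (y - b)"
        using norm_triangle_ineq[of "y - b" "b - x"] by simp_all
      then have "max 0 (norm (y - x) - d) - max 0 (norm (b - x) - d) \<le> norm (y - b)"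
        by linarith
      then have "5 * e * (max 0 (norm (y - x) - d) - max 0 (norm (b - x) - d)) \<le> 5 * e * norm (y - b)"
        using e by (intro mult_left_mono) auto
      moreover have "(\<eta> + e' / 2) * norm (y - b) \<le> e * norm (y - b)"
        using \<eta> e' by (intro mult_right_mono) auto
      moreover have "0 \<le> e * norm (y - b)"
        using e by simp
      ultimately show "v (y - b) \<le> 8 * e * norm (y - b)"
        using v_le[OF in_C[OF y]] by (simp add: algebra_simps)
    qed
    show "approx_normal A b (min (d / 2) (r / 2)) e' v"
      unfolding approx_normal_def
    proof (intro ballI impI)
      fix y assume y: "y \<in> A" "norm (y - b) \<le> min (d / 2) (r / 2)"
      then have "norm (y - x) \<le> d" "norm (b - x) \<le> d"
        using norm_triangle_ineq[of "y - b" "b - x"] b(2) \<eta>(2) d by (auto simp: dist_norm)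
      then have "v (y - b) \<le> (\<eta> + e' / 2) * norm (y - b)"
        using v_le[of y] in_C[of y] y by (simp add: algebra_simps)
      also have "\<dots> \<le> e' * norm (y - b)"
        using \<eta> by (intro mult_right_mono) auto
      finally show "v (y - b) \<le> e' * norm (y - b)" .
    qed
  qed
qed

lemma halving_tendsto_zero:
  fixes c :: "nat \<Rightarrow> real"
  assumes nonneg: "\<And>n. c n \<ge> 0" and half: "\<And>n. c (Suc n) \<le> c n / 2"
  shows "c \<longlonglongrightarrow> 0"
proof (rule tendsto_sandwich[where f = "\<lambda>_. 0" and h = "\<lambda>n. c 0 * (1/2) ^ n"])
  have "c n \<le> c 0 * (1/2) ^ n" for n
  proof (induction n)
    case (Suc n)
    then show ?case using half[of n] by simp
  qed simp
  then show "\<forall>\<^sub>F n in sequentially. c n \<le> c 0 * (1/2) ^ n"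
    by simp
  show "(\<lambda>n. c 0 * (1/2) ^ n) \<longlonglongrightarrow> 0"
    by (intro tendsto_mult_right_zero LIMSEQ_power_zero) simp
qed (use nonneg in auto)

lemma halving_steps_converge:
  fixes s :: "nat \<Rightarrow> 'b::complete_space" and c :: "nat \<Rightarrow> real"
  assumes step: "\<And>n. dist (s (Suc n)) (s n) \<le> c n" and half: "\<And>n. c (Suc n) \<le> c n / 2"
  obtains x where "s \<longlonglongrightarrow> x" "\<And>n. dist x (s n) \<le> 2 * c n"
proof -
  have c_ge: "c n \<ge> 0" for n
    using step[of n] zero_le_dist order_trans by blast
  then have c_lim: "c \<longlonglongrightarrow> 0"
    using half by (rule halving_tendsto_zero)
  have "dist (s (m + k)) (s m) \<le> 2 * c m - 2 * c (m + k)" for m k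
  proof (induction k)
    case (Suc k)
    then show ?case
      using step[of "m + k"] half[of "m + k"] dist_triangle[of "s (m + Suc k)" "s m" "s (m + k)"]
      by simp
  qed simp
  then have near: "dist (s n) (s m) \<le> 2 * c m" if "n \<ge> m" for n m
    using that c_ge by (smt (verit) le_Suc_ex)
  have "Cauchy s"
  proof (rule metric_CauchyI)
    fix e :: real assume "e > 0"
    then obtain n where n: "c n < e / 4"
      using order_tendstoD(2)[OF c_lim, of "e / 4"] by (auto simp: eventually_sequentially)
    have "dist (s i) (s j) < e" if "i \<ge> n" "j \<ge> n" for i j
      using near[OF that(1)] near[OF that(2)] n dist_triangle2[of "s i" "s j" "s n"] by linarith
    then show "\<exists>M. \<forall>m\<ge>M. \<forall>n\<ge>M. dist (s m) (s n) < e"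
      by blast
  qed
  then obtain x where x: "s \<longlonglongrightarrow> x"
    using Cauchy_convergent convergent_def by blast
  have "dist x (s n) \<le> 2 * c n" for n
    by (rule Lim_bounded[where M = n]) (auto intro!: tendsto_dist x near)
  then show thesis
    using that x by blast
qed

text \<open>Refining infinitely often with precisions \<open>\<epsilon> n = e / 2^n\<close> yields base points, functionals and radii
  \<open>\<rho> n\<close>; points and functionals converge to some \<open>b\<close> and \<open>v\<close>. For \<open>x\<close> at a distance from \<open>b\<close> between
  \<open>\<rho> (m + 1) / 4\<close> and \<open>\<rho> m / 4\<close>, the functional number \<open>m + 1\<close> has precision \<open>8 \<epsilon> m\<close> by the
  property of radius \<open>\<rho> m / 2\<close>. All later moves of the base point are much smaller than
  \<open>\<rho> (m + 1)\<close>, hence than this distance, so the estimate passes to \<open>b\<close> and \<open>v\<close>. These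
  scales cover all small distances and \<open>\<epsilon> m\<close> tends to 0, so \<open>v\<close> is an exact normal at \<open>b\<close>.\<close>

lemma approx_normal_imp_near_frechet_normal:
  fixes A :: "'a::banach set"
  assumes asplund: "asplund_space TYPE('a)" and A: "closed A" and a: "a \<in> A"
    and normal: "approx_normal A a r e w" and e: "e > 0" and r: "r > 0" and l: "l > 0"
  obtains b v where "b \<in> A" "dist b a \<le> l" "v \<in> frechet_normal_cone A b" "norm (v - w) \<le> 6 * e"
proof -
  define \<epsilon> where "\<epsilon> n = e * (1/2) ^ n" for n :: nat
  have \<epsilon>: "\<epsilon> n > 0" "\<epsilon> (Suc n) = \<epsilon> n / 2" for n
    using e by (simp_all add: \<epsilon>_def)
  have \<epsilon>_mono: "\<epsilon> m \<le> \<epsilon> n" if "n \<le> m" for n m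
    using e that by (simp add: \<epsilon>_def power_decreasing)
  define W where "W = norm w + 12 * e"
  have W: "W > 0"
    using e by (simp add: W_def add_nonneg_pos)
  \<comment> \<open>The base point moves by at most \<open>\<kappa> * \<epsilon> n * \<rho> n\<close>. The bounds on \<open>\<kappa>\<close> keep later moves small compared
    with the radius, keep the total move below \<open>l\<close>, and keep the error small that such a move causes
    in a functional of norm at most \<open>W\<close>.\<close>
  define \<kappa> where "\<kappa> = min (1 / (16 * e)) (min (l / (2 * e * r)) (1 / (8 * W)))"
  have \<kappa>: "\<kappa> > 0" and "\<kappa> \<le> 1 / (16 * e)" "\<kappa> \<le> l / (2 * e * r)" "\<kappa> \<le> 1 / (8 * W)"
    using e r l W by (auto simp: \<kappa>_def)
  then have \<kappa>_le: "\<kappa> * e \<le> 1 / 16" "2 * (\<kappa> * e * r) \<le> l" "\<kappa> * W \<le> 1 / 8"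
    using e r W by (simp_all add: field_simps)
  define P where "P n = (\<lambda>(b, v, t). b \<in> A \<and> t > 0 \<and> approx_normal A b t (\<epsilon> n) v
      \<and> (n = 0 \<longrightarrow> b = a \<and> v = w \<and> t = r))" for n
  define Q where "Q n = (\<lambda>(b, v, t) (b', v', t'). dist b' b \<le> \<kappa> * \<epsilon> n * t \<and> norm (v' - v) \<le> 3 * \<epsilon> n
      \<and> t' \<le> t / 2 \<and> approx_normal A b' (t / 2) (8 * \<epsilon> n) v')" for n
  have "\<exists>s. \<forall>n. P n (s n) \<and> Q n (s n) (s (Suc n))"
  proof (rule dependent_nat_choice)
    have "P 0 (a, w, r)"
      using a r normal by (simp add: P_def \<epsilon>_def)
    then show "\<exists>x. P 0 x" ..
    fix x n assume Px: "P n x"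
    obtain b v t where x: "x = (b, v, t)"
      by (cases x)
    have bvt: "b \<in> A" "t > 0" "approx_normal A b t (\<epsilon> n) v"
      using Px by (auto simp: P_def x)
    have "\<kappa> * \<epsilon> n * t > 0"
      using \<kappa> \<epsilon> bvt by simp
    then obtain b' v' t' where *: "b' \<in> A" "dist b' b \<le> \<kappa> * \<epsilon> n * t" "norm (v' - v) \<le> 3 * \<epsilon> n" "t' > 0"
      "approx_normal A b' (t / 2) (8 * \<epsilon> n) v'" "approx_normal A b' t' (\<epsilon> (Suc n)) v'"
      using approx_normal_refine[OF asplund A bvt(1,3) \<epsilon>(1) bvt(2) \<epsilon>(1)[of "Suc n"]] \<epsilon>
      by (metis field_sum_of_halves less_add_same_cancel1 less_eq_real_def half_gt_zero)
    have "approx_normal A b' (min t' (t / 2)) (\<epsilon> (Suc n)) v'"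
      using *(6) by (rule approx_normal_mono) auto
    then have "P (Suc n) (b', v', min t' (t / 2)) \<and> Q n x (b', v', min t' (t / 2))"
      using * bvt by (simp add: P_def Q_def x)
    then show "\<exists>y. P (Suc n) y \<and> Q n x y" ..
  qed
  then obtain s where PQ: "\<And>n. P n (s n)" "\<And>n. Q n (s n) (s (Suc n))"
    by blast
  define p where "p n = fst (s n)" for n
  define u where "u n = fst (snd (s n))" for n
  define \<rho> where "\<rho> n = snd (snd (s n))" for n
  have s: "s n = (p n, u n, \<rho> n)" for n
    by (simp add: p_def u_def \<rho>_def)
  have start: "p 0 = a" "u 0 = w" "\<rho> 0 = r" and p: "\<And>n. p n \<in> A" and \<rho>: "\<And>n. \<rho> n > 0"
    using PQ(1) unfolding P_def s by (auto dest: spec[of _ 0])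
  have p_step: "dist (p (Suc n)) (p n) \<le> \<kappa> * \<epsilon> n * \<rho> n"
    and u_step: "dist (u (Suc n)) (u n) \<le> 3 * \<epsilon> n"
    and \<rho>_half: "\<rho> (Suc n) \<le> \<rho> n / 2"
    and normal_Suc: "approx_normal A (p (Suc n)) (\<rho> n / 2) (8 * \<epsilon> n) (u (Suc n))" for n
    using PQ(2)[of n] unfolding Q_def s by (auto simp: dist_norm)
  have "\<kappa> * \<epsilon> (Suc n) * \<rho> (Suc n) \<le> \<kappa> * \<epsilon> n * \<rho> n / 2" for n
  proof -
    have "\<kappa> * \<epsilon> n / 2 * \<rho> (Suc n) \<le> \<kappa> * \<epsilon> n / 2 * \<rho> n"
      using \<rho>_half[of n] \<rho>[of n] \<kappa> \<epsilon>(1)[of n] by (intro mult_left_mono) auto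
    then show ?thesis
      by (simp add: \<epsilon>(2))
  qed
  then obtain b where b: "p \<longlonglongrightarrow> b" and p_near: "\<And>n. dist b (p n) \<le> 2 * (\<kappa> * \<epsilon> n * \<rho> n)"
    using halving_steps_converge[of p "\<lambda>n. \<kappa> * \<epsilon> n * \<rho> n"] p_step by blast
  have "3 * \<epsilon> (Suc n) \<le> 3 * \<epsilon> n / 2" for n
    unfolding \<epsilon>(2) by simp
  with u_step obtain v where u_near: "\<And>n. dist v (u n) \<le> 2 * (3 * \<epsilon> n)"
    using halving_steps_converge[of u "\<lambda>n. 3 * \<epsilon> n"] by blast
  have u_le: "norm (u n) \<le> W" for n
    using u_near[of n] u_near[of 0] \<epsilon>_mono[of 0 n] norm_triangle_ineq4[of "v - u 0" "v - u n"]
      norm_triangle_ineq[of "u n - w" w]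
    by (simp add: start W_def \<epsilon>_def dist_norm)
  have \<rho>_lim: "\<rho> \<longlonglongrightarrow> 0"
    using \<rho> \<rho>_half by (intro halving_tendsto_zero) (auto intro: less_imp_le)
  have "v \<in> frechet_normal_cone A b"
    unfolding mem_frechet_normal_cone_iff
  proof (intro allI impI)
    fix \<eta> :: real assume "\<eta> > 0"
    have "\<epsilon> \<longlonglongrightarrow> 0"
      unfolding \<epsilon>_def by (intro tendsto_mult_right_zero LIMSEQ_power_zero) simp
    then obtain n where n: "\<epsilon> n < \<eta> / 20"
      using order_tendstoD(2)[of \<epsilon> 0 sequentially "\<eta> / 20"] \<open>\<eta> > 0\<close>
      by (auto simp: eventually_sequentially)
    have "v (x - b) \<le> \<eta> * norm (x - b)" if x: "x \<in> A \<inter> ball b (\<rho> n / 4)" for x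
    proof (cases "x = b")
      case False
      then have pos: "norm (x - b) > 0"
        by simp
      then have "\<forall>\<^sub>F j in sequentially. \<rho> j < 4 * norm (x - b)"
        by (intro order_tendstoD(2)[OF \<rho>_lim]) simp
      then obtain j where "\<rho> j < 4 * norm (x - b)"
        unfolding eventually_sequentially by blast
      then have "\<exists>j. \<rho> j / 4 < norm (x - b)"
        by (intro exI[of _ j]) simp
      moreover have not_le: "\<not> \<rho> j / 4 < norm (x - b)" if "j \<le> n" for j
      proof -
        have "\<rho> n \<le> \<rho> j"
          using \<open>j \<le> n\<close> by (rule lift_Suc_antimono_le[rotated]) (smt (verit) \<rho> \<rho>_half field_sum_of_halves)
        then show ?thesis
          using x by (simp add: dist_norm norm_minus_commute)
      qed
      ultimately obtain m where m: "\<rho> (Suc m) / 4 < norm (x - b)" "norm (x - b) \<le> \<rho> m / 4"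
        using exists_least_lemma[of "\<lambda>j. \<rho> j / 4 < norm (x - b)"] by (force simp: not_less)
      have "n \<le> m"
        using not_le[of "Suc m"] m(1) by linarith
      define q where "q = p (Suc m)"
      have qb: "norm (q - b) \<le> 2 * (\<kappa> * \<epsilon> (Suc m) * \<rho> (Suc m))"
        using p_near[of "Suc m"] by (simp add: q_def dist_norm norm_minus_commute)
      have "\<kappa> * \<epsilon> (Suc m) \<le> \<kappa> * e"
        using \<epsilon>_mono[of 0 "Suc m"] \<kappa> by (simp add: \<epsilon>_def)
      then have "\<kappa> * \<epsilon> (Suc m) * \<rho> (Suc m) \<le> 1 / 16 * \<rho> (Suc m)"
        using \<kappa>_le(1) \<rho>[of "Suc m"] by (intro mult_right_mono) auto
      then have "norm (q - b) \<le> norm (x - b)"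
        using qb m(1) pos by linarith
      then have xq: "norm (x - q) \<le> 2 * norm (x - b)"
        using norm_triangle_ineq4[of "x - b" "q - b"] by simp
      have "W * norm (q - b) \<le> W * (2 * (\<kappa> * \<epsilon> (Suc m) * \<rho> (Suc m)))"
        using qb W by (intro mult_left_mono) auto
      also have "\<dots> = 2 * ((\<kappa> * W) * (\<epsilon> (Suc m) * \<rho> (Suc m)))"
        by simp
      also have "\<dots> \<le> 2 * (1 / 8 * (\<epsilon> (Suc m) * \<rho> (Suc m)))"
        using \<kappa>_le(3) \<epsilon>(1)[of "Suc m"] \<rho>[of "Suc m"] by (intro mult_left_mono mult_right_mono) auto
      also have "\<dots> = \<epsilon> (Suc m) * (\<rho> (Suc m) / 4)"
        by simp
      also have "\<dots> \<le> \<epsilon> (Suc m) * norm (x - b)"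
        using m(1) \<epsilon>(1)[of "Suc m"] by (intro mult_left_mono) auto
      finally have Wq: "W * norm (q - b) \<le> \<epsilon> m / 2 * norm (x - b)"
        by (simp add: \<epsilon>(2))
      have "u (Suc m) (q - b) \<le> norm (u (Suc m)) * norm (q - b)"
        using norm_blinfun[of "u (Suc m)" "q - b"] by simp
      also have "\<dots> \<le> W * norm (q - b)"
        by (intro mult_right_mono u_le) simp
      finally have 1: "u (Suc m) (q - b) \<le> \<epsilon> m / 2 * norm (x - b)"
        using Wq by simp
      have "(v - u (Suc m)) (x - b) \<le> norm (v - u (Suc m)) * norm (x - b)"
        using norm_blinfun[of "v - u (Suc m)" "x - b"] by simp
      also have "\<dots> \<le> 3 * \<epsilon> m * norm (x - b)"
        using u_near[of "Suc m"] by (intro mult_right_mono) (auto simp: dist_norm \<epsilon>(2))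
      finally have 2: "(v - u (Suc m)) (x - b) \<le> 3 * \<epsilon> m * norm (x - b)" .
      have "norm (x - q) \<le> \<rho> m / 2"
        using xq m(2) by simp
      then have "u (Suc m) (x - q) \<le> 8 * \<epsilon> m * norm (x - q)"
        using normal_Suc[of m] x unfolding q_def by (intro approx_normalD) auto
      also have "\<dots> \<le> 8 * \<epsilon> m * (2 * norm (x - b))"
        using xq \<epsilon>(1)[of m] by (intro mult_left_mono) auto
      finally have 3: "u (Suc m) (x - q) \<le> 16 * \<epsilon> m * norm (x - b)"
        by simp
      have "v (x - b) = (v - u (Suc m)) (x - b) + u (Suc m) (x - q) + u (Suc m) (q - b)"
        by (simp add: blinfun.diff_left blinfun.diff_right)
      also have "\<dots> \<le> 20 * (\<epsilon> m * norm (x - b))"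
        using 1 2 3 mult_pos_pos[OF \<epsilon>(1)[of m] pos] by linarith
      also have "\<dots> \<le> 20 * (\<eta> / 20 * norm (x - b))"
        using n \<epsilon>_mono[OF \<open>n \<le> m\<close>] by (intro mult_left_mono mult_right_mono) auto
      finally show ?thesis
        by simp
    qed (simp add: blinfun.zero_right)
    then show "\<exists>\<delta>>0. \<forall>x \<in> A \<inter> ball b \<delta>. v (x - b) \<le> \<eta> * norm (x - b)"
      using \<rho>[of n] by (intro exI[of _ "\<rho> n / 4"]) auto
  qed
  moreover have "b \<in> A"
    using A b p closed_sequentially by blast
  moreover have "dist b a \<le> l"
    using p_near[of 0] \<kappa>_le(2) by (simp add: start \<epsilon>_def)
  moreover have "norm (v - w) \<le> 6 * e"
    using u_near[of 0] by (simp add: start \<epsilon>_def dist_norm)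
  ultimately show thesis
    using that by blast
qed

section \<open>Normals from extremality\<close>

text \<open>Ekeland's principle with cone slope \<open>\<eta>\<close> trades the additive error \<open>\<eta> * \<eta>\<close> for a move of the base
  point by \<open>\<eta>\<close> and a loss \<open>\<eta>\<close> of precision.\<close>

lemma approx_normal_near_additive_error:
  fixes A :: "'a::banach set"
  assumes A: "closed A" and a: "a \<in> A" and \<eta>: "0 < \<eta>" "\<eta> \<le> d / 2" and e: "e \<ge> 0"
    and le: "\<And>x. x \<in> A \<Longrightarrow> norm (x - a) \<le> d \<Longrightarrow> blinfun_apply w (x - a) \<le> e * norm (x - a) + \<eta> * \<eta>"
  obtains b where "b \<in> A" "dist b a \<le> \<eta>" "approx_normal A b (d / 2) (e + \<eta>) w"
proof -
  define C where "C = A \<inter> cball a d"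
  define g where "g x = e * norm (x - a) - w (x - a)" for x
  have C: "complete C" "a \<in> C"
    using A a \<eta> by (simp_all add: C_def complete_eq_closed closed_Int)
  moreover have "continuous_on C g"
    unfolding g_def by (intro continuous_intros)
  moreover have "g a - \<eta> * \<eta> \<le> g x" if "x \<in> C" for x
    using le[of x] that by (simp add: g_def C_def dist_norm norm_minus_commute blinfun.zero_right)
  ultimately obtain b where b: "b \<in> C" "dist b a \<le> \<eta>"
    and b_min: "\<And>x. x \<in> C \<Longrightarrow> g b - \<eta> * dist x b \<le> g x"
    using ekeland_variational_principle[of C g a \<eta> \<eta>] \<eta> by blast
  have "approx_normal A b (d / 2) (e + \<eta>) w"
    unfolding approx_normal_def
  proof (intro ballI impI)
    fix x assume x: "x \<in> A" "norm (x - b) \<le> d / 2"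
    have tri: "norm (x - a) \<le> norm (x - b) + norm (b - a)"
      using norm_triangle_ineq[of "x - b" "b - a"] by simp
    then have "x \<in> C"
      using x b(2) \<eta> by (simp add: C_def dist_norm norm_minus_commute)
    moreover have "e * norm (x - a) \<le> e * (norm (x - b) + norm (b - a))"
      using tri e by (rule mult_left_mono)
    ultimately show "w (x - b) \<le> (e + \<eta>) * norm (x - b)"
      using b_min[of x] by (simp add: g_def dist_norm blinfun.diff_right algebra_simps)
  qed
  then show thesis
    using that b by (auto simp: C_def)
qed

text \<open>Extremality provides arbitrarily small \<open>y\<close> outside \<open>A - B\<close>. Distances to \<open>A - B\<close> may vanish at
  \<open>y\<close>, as \<open>A - B\<close> need not be closed, so Ekeland's principle first selects \<open>a0\<close> and \<open>b0\<close> such that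
  \<open>|a - b - y| + \<kappa> (|a - a0| + |b - b0|)\<close> is minimal, with a positive value \<open>h\<close>, at \<open>(a0, b0)\<close>. Then
  \<open>F z\<close>, the infimum of \<open>|a - b - z| + 2 \<kappa> (|a - a0| + |b - b0|)\<close>, replaces the distance from \<open>z\<close>
  to \<open>A - B\<close>; the factor 2 makes approximate minimisers for \<open>z\<close> near \<open>y\<close> stay near \<open>(a0, b0)\<close>.

  Let \<open>z'\<close> be an approximate subgradient of \<open>F\<close> at \<open>z\<close>, and \<open>a\<close>, \<open>b\<close> almost minimising. Moving \<open>a\<close> to
  \<open>x\<close> in \<open>A\<close> and \<open>z\<close> to \<open>z + (x - a)\<close> leaves \<open>a - b - z\<close> unchanged and hardly changes the value,
  so \<open>z'\<close> is almost normal to \<open>A\<close> at \<open>a\<close>; moving \<open>b\<close> and \<open>z\<close> in opposite directions shows that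
  \<open>- z'\<close> is almost normal to \<open>B\<close> at \<open>b\<close>. Moving \<open>z\<close> towards \<open>a - b\<close> decreases \<open>F\<close> at almost unit speed,
  which keeps \<open>z'\<close> away from 0.\<close>

lemma extremal_pair_approx_normals:
  fixes A B :: "'a::banach set"
  assumes asplund: "asplund_space TYPE('a)" and A: "closed A" and B: "closed B"
    and \<xi>: "\<xi> \<in> A \<inter> B" and ext: "extremal_pair A B" and e: "0 < e" "e \<le> 1"
  obtains a b w r where "a \<in> A" "b \<in> B" "dist a \<xi> < e" "dist b \<xi> < e" "norm w \<ge> 1 / 2" "r > 0"
    "approx_normal A a r e w" "approx_normal B b r e (- w)"
proof -
  define \<kappa> where "\<kappa> = e / 8"
  have \<kappa>: "\<kappa> > 0"
    using e by (simp add: \<kappa>_def)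
  have "\<kappa> * (e / 4) / 2 > 0"
    using e \<kappa> by simp
  then obtain u v where uv: "(\<lambda>x. x - u) ` A \<inter> (\<lambda>x. x - v) ` B = {}"
    and small: "max (norm u) (norm v) < \<kappa> * (e / 4) / 2"
    using ext unfolding extremal_pair_def by blast
  define y where "y = u - v"
  have y: "norm y \<le> \<kappa> * (e / 4)"
    using small norm_triangle_ineq4[of u v] by (simp add: y_def)
  have "complete (A \<times> B)"
    using A B by (simp add: complete_eq_closed closed_Times)
  moreover have "continuous_on (A \<times> B) (\<lambda>ab. norm (fst ab - snd ab - y))"
    by (intro continuous_intros)
  moreover have "(\<xi>, \<xi>) \<in> A \<times> B"
    using \<xi> by simp
  moreover note \<kappa>
  moreover have "norm (fst (\<xi>, \<xi>) - snd (\<xi>, \<xi>) - y) - \<kappa> * (e / 4) \<le> norm (fst ab - snd ab - y)"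
    for ab :: "'a \<times> 'a"
  proof -
    have "norm (\<xi> - \<xi> - y) \<le> \<kappa> * (e / 4)"
      using y by simp
    then show ?thesis
      using norm_ge_zero[of "fst ab - snd ab - y"] unfolding fst_conv snd_conv by linarith
  qed
  ultimately obtain ab0 where ab0: "ab0 \<in> A \<times> B" "dist ab0 (\<xi>, \<xi>) \<le> e / 4"
    "\<And>ab. ab \<in> A \<times> B \<Longrightarrow> norm (fst ab0 - snd ab0 - y) - \<kappa> * dist ab ab0 \<le> norm (fst ab - snd ab - y)"
    by (rule ekeland_variational_principle[of "A \<times> B" "\<lambda>ab. norm (fst ab - snd ab - y)"]) (rule that)
  obtain a0 b0 where ab0_eq: "ab0 = (a0, b0)"
    by (cases ab0)
  have a0: "a0 \<in> A" "dist a0 \<xi> \<le> e / 4" and b0: "b0 \<in> B" "dist b0 \<xi> \<le> e / 4"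
    using ab0(1,2) dist_fst_le[of ab0 "(\<xi>, \<xi>)"] dist_snd_le[of ab0 "(\<xi>, \<xi>)"] by (auto simp: ab0_eq)
  define h where "h = norm (a0 - b0 - y)"
  have h_min: "h - \<kappa> * (norm (a - a0) + norm (b - b0)) \<le> norm (a - b - y)" if "a \<in> A" "b \<in> B" for a b
  proof -
    have "dist (a, b) (a0, b0) \<le> norm (a - a0) + norm (b - b0)"
      by (simp add: dist_norm norm_Pair_le)
    then have "\<kappa> * dist (a, b) (a0, b0) \<le> \<kappa> * (norm (a - a0) + norm (b - b0))"
      using \<kappa> by (intro mult_left_mono) auto
    then show ?thesis
      using ab0(3)[of "(a, b)"] that by (simp add: ab0_eq h_def)
  qed
  have "a0 - u \<noteq> b0 - v"
    using uv a0 b0 by blast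
  then have h: "h > 0"
    by (auto simp: h_def y_def algebra_simps)
  define \<phi> where "\<phi> = (\<lambda>(a, b) z. norm (a - b - z) + 2 * \<kappa> * (norm (a - a0) + norm (b - b0)))"
  define F where "F z = (INF ab\<in>A \<times> B. \<phi> ab z)" for z
  have bdd: "bdd_below ((\<lambda>ab. \<phi> ab z) ` (A \<times> B))" for z
    using \<kappa> by (intro bdd_belowI[of _ 0]) (auto simp: \<phi>_def)
  have F_le: "F z \<le> norm (a - b - z) + 2 * \<kappa> * (norm (a - a0) + norm (b - b0))"
    if "a \<in> A" "b \<in> B" for a b z
    using cINF_lower[OF bdd, of "(a, b)" z] that by (simp add: F_def \<phi>_def)
  have F_lip: "1-lipschitz_on UNIV F"
    unfolding F_def
  proof (rule lipschitz_on_INF)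
    fix ab :: "'a \<times> 'a"
    show "1-lipschitz_on UNIV (\<phi> ab)"
    proof (rule lipschitz_onI)
      fix x z
      show "dist (\<phi> ab x) (\<phi> ab z) \<le> 1 * dist x z"
        using norm_triangle_ineq3[of "fst ab - snd ab - x" "fst ab - snd ab - z"]
        by (simp add: \<phi>_def case_prod_unfold dist_norm norm_minus_commute)
    qed simp
  qed (use bdd a0 b0 in auto)
  \<comment> \<open>The radius \<open>m\<close> and the minimisation error \<open>\<eta> * \<eta>\<close> are small against \<open>\<kappa> * e\<close>, for the distance of the
    minimiser from \<open>(a0, b0)\<close>, and against \<open>h\<close>, to keep \<open>a - b - z\<close> away from 0.\<close>
  define m where "m = min (h / 8) (\<kappa> * e / 16)"
  have m: "m > 0" "m \<le> h / 8" "m \<le> \<kappa> * e / 16"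
    using h \<kappa> e by (auto simp: m_def)
  have "e / 4 > 0"
    using e by simp
  then obtain z z' d where z: "z \<in> ball y m" and d: "d > 0"
    and sub: "\<And>k. norm k \<le> d \<Longrightarrow> F z + blinfun_apply z' k - e / 4 * norm k \<le> F (z + k)"
    using asplund_approx_subgradient[OF asplund F_lip m(1)] by metis
  have yz: "norm (z - y) \<le> m"
    using z by (simp add: dist_norm norm_minus_commute)
  \<comment> \<open>A fraction \<open>t\<close> of the way from \<open>z\<close> to \<open>a - b\<close>, whose length is at most \<open>2 * h\<close>, stays within \<open>d\<close>;
    it is fixed before \<open>a\<close> and \<open>b\<close> because \<open>\<eta>\<close> depends on it.\<close>
  define t where "t = min 1 (d / (2 * h))"
  have t: "t > 0" "t \<le> 1" "t * (2 * h) \<le> d"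
    using d h by (auto simp: t_def min_def field_simps)
  define \<eta> where "\<eta> = min (min 1 (\<kappa> * e / 8)) (min (min (t * h / 8) (e / 4)) (d / 2))"
  have \<eta>: "\<eta> > 0" "\<eta> \<le> 1" "\<eta> \<le> \<kappa> * e / 8" "\<eta> \<le> t * h / 8" "\<eta> \<le> e / 4" "\<eta> \<le> d / 2"
    using t \<kappa> e d h by (auto simp: \<eta>_def)
  have "t * h \<le> h"
    using t h by simp
  then have \<eta>_h: "\<eta> \<le> h / 8"
    using \<eta>(4) by simp
  have \<eta>\<eta>: "\<eta> * \<eta> \<le> \<eta>"
    using \<eta> by (simp add: mult_left_le)
  have "\<exists>q \<in> (\<lambda>ab. \<phi> ab z) ` (A \<times> B). q < F z + \<eta> * \<eta>"
    unfolding F_def using a0 b0 \<eta> by (intro cInf_lessD) auto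
  then obtain a b where a: "a \<in> A" and b: "b \<in> B"
    and min: "norm (a - b - z) + 2 * \<kappa> * (norm (a - a0) + norm (b - b0)) < F z + \<eta> * \<eta>"
    by (auto simp: \<phi>_def)
  define D where "D = norm (a - a0) + norm (b - b0)"
  define q where "q = a - b - z"
  have q_min: "norm q + 2 * \<kappa> * D < F z + \<eta> * \<eta>"
    using min by (simp add: q_def D_def)
  have "norm (a0 - b0 - z) \<le> h + m"
    using norm_triangle_ineq4[of "a0 - b0 - y" "z - y"] yz by (simp add: h_def)
  then have F_upper: "F z \<le> h + m"
    using F_le[OF a0(1) b0(1), of z] by simp
  have q_lower: "h - \<kappa> * D - m \<le> norm q"
    using h_min[OF a b] norm_triangle_ineq[of q "z - y"] yz by (simp add: q_def D_def)
  have D_small: "\<kappa> * D \<le> 2 * m + \<eta>"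
    using q_lower q_min F_upper \<eta>\<eta> by simp
  also have "\<dots> \<le> \<kappa> * (e / 4)"
    using m \<eta> by simp
  finally have D: "D \<le> e / 4"
    using \<kappa> by simp
  have q_ge: "h / 2 \<le> norm q"
    using q_lower D_small m \<eta>_h by simp
  have "0 \<le> 2 * \<kappa> * D"
    using \<kappa> by (simp add: D_def)
  then have q_le: "norm q \<le> 2 * h"
    using q_min F_upper m \<eta>_h \<eta>\<eta> h by linarith
  have "norm z' \<ge> 1 / 2"
  proof -
    have tq: "t * norm q \<le> d"
      using mult_left_mono[OF q_le, of t] t by linarith
    have "a - b - (z + t *\<^sub>R q) = (1 - t) *\<^sub>R q"
      by (simp add: q_def algebra_simps)
    then have "F (z + t *\<^sub>R q) \<le> (1 - t) * norm q + 2 * \<kappa> * D"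
      using F_le[OF a b, of "z + t *\<^sub>R q"] t by (simp add: D_def)
    then have "t * z' q \<le> \<eta> * \<eta> - t * norm q + e / 4 * (t * norm q)"
      using sub[of "t *\<^sub>R q"] tq t q_min by (simp add: blinfun.scaleR_right algebra_simps)
    also have "\<eta> * \<eta> \<le> t * norm q / 4"
      using \<eta>\<eta> \<eta>(4) mult_left_mono[OF q_ge, of t] t(1) by linarith
    also have "e / 4 * (t * norm q) \<le> 1 / 4 * (t * norm q)"
      using e t by (intro mult_right_mono) auto
    finally have "t * z' q \<le> t * (- (1 / 2 * norm q))"
      by (simp add: algebra_simps)
    then have "1 / 2 * norm q \<le> - z' q"
      using t(1) by (simp only: mult_le_cancel_left_pos)
    also have "\<dots> \<le> norm z' * norm q"
      using norm_blinfun[of z' q] by simp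
    finally have "1 / 2 * norm q \<le> norm z' * norm q" .
    moreover have "norm q > 0"
      using q_ge h by linarith
    ultimately show ?thesis
      by (simp only: mult_le_cancel_right_pos)
  qed
  moreover
  have "z' (x - a) \<le> e / 2 * norm (x - a) + \<eta> * \<eta>" if x: "x \<in> A" "norm (x - a) \<le> d" for x
  proof -
    have "x - b - (z + (x - a)) = q"
      by (simp add: q_def)
    then have "F (z + (x - a)) \<le> norm q + 2 * \<kappa> * (norm (x - a0) + norm (b - b0))"
      using F_le[OF x(1) b, of "z + (x - a)"] by simp
    moreover have "2 * \<kappa> * norm (x - a0) \<le> 2 * \<kappa> * (norm (x - a) + norm (a - a0))"
      using norm_triangle_ineq[of "x - a" "a - a0"] \<kappa> by (intro mult_left_mono) auto
    ultimately show ?thesis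
      using sub[OF x(2)] q_min by (simp add: D_def \<kappa>_def algebra_simps)
  qed
  then obtain a1 where a1: "a1 \<in> A" "dist a1 a \<le> \<eta>" "approx_normal A a1 (d / 2) (e / 2 + \<eta>) z'"
    using approx_normal_near_additive_error[OF A a \<eta>(1,6), of "e / 2" z'] e by auto
  moreover
  have "(- z') (x - b) \<le> e / 2 * norm (x - b) + \<eta> * \<eta>" if x: "x \<in> B" "norm (x - b) \<le> d" for x
  proof -
    have "a - x - (z + (b - x)) = q"
      by (simp add: q_def)
    then have "F (z + (b - x)) \<le> norm q + 2 * \<kappa> * (norm (a - a0) + norm (x - b0))"
      using F_le[OF a x(1), of "z + (b - x)"] by simp
    moreover have "2 * \<kappa> * norm (x - b0) \<le> 2 * \<kappa> * (norm (x - b) + norm (b - b0))"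
      using norm_triangle_ineq[of "x - b" "b - b0"] \<kappa> by (intro mult_left_mono) auto
    ultimately show ?thesis
      using sub[of "b - x"] x(2) q_min
      by (simp add: D_def \<kappa>_def norm_minus_commute blinfun.diff_right blinfun.minus_left algebra_simps)
  qed
  then obtain b1 where b1: "b1 \<in> B" "dist b1 b \<le> \<eta>" "approx_normal B b1 (d / 2) (e / 2 + \<eta>) (- z')"
    using approx_normal_near_additive_error[OF B b \<eta>(1,6), of "e / 2" "- z'"] e by auto
  moreover have "dist a1 \<xi> < e"
    using a1(2) a0(2) D \<eta>(5) e(1) dist_triangle[of a1 \<xi> a] dist_triangle[of a \<xi> a0] norm_ge_zero[of "b - b0"]
    unfolding D_def dist_norm by linarith
  moreover have "dist b1 \<xi> < e"
    using b1(2) b0(2) D \<eta>(5) e(1) dist_triangle[of b1 \<xi> b] dist_triangle[of b \<xi> b0] norm_ge_zero[of "a - a0"]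
    unfolding D_def dist_norm by linarith
  moreover have "approx_normal A a1 (d / 2) e z'" "approx_normal B b1 (d / 2) e (- z')"
    using a1(3) b1(3) \<eta>(5) e(1) by (auto elim!: approx_normal_mono)
  ultimately show thesis
    using that[of a1 b1 z' "d / 2"] d by auto
qed

section \<open>The extremal principle and its two forms\<close>

lemma scaleR_in_frechet_normal_cone:
  assumes w: "w \<in> frechet_normal_cone A a" and s: "s > 0"
  shows "s *\<^sub>R w \<in> frechet_normal_cone A a"
  unfolding mem_frechet_normal_cone_iff
proof (intro allI impI)
  fix \<eta> :: real assume "\<eta> > 0"
  then have "\<eta> / s > 0"
    using s by simp
  then obtain \<delta> where "\<delta> > 0" "\<forall>x \<in> A \<inter> ball a \<delta>. w (x - a) \<le> \<eta> / s * norm (x - a)"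
    using w unfolding mem_frechet_normal_cone_iff by blast
  then show "\<exists>\<delta>>0. \<forall>x \<in> A \<inter> ball a \<delta>. (s *\<^sub>R w) (x - a) \<le> \<eta> * norm (x - a)"
    using s by (intro exI[of _ \<delta>]) (auto simp: blinfun.scaleR_left field_simps)
qed

lemma zero_in_frechet_normal_cone: "0 \<in> frechet_normal_cone A a"
  unfolding mem_frechet_normal_cone_iff by (auto intro!: exI[of _ 1])

text \<open>The cones allow rescaling, so normals whose norms sum to at least \<open>1/2\<close> can be normalised at the
  cost of a factor 2 in the size of their sum.\<close>

lemma normal_sum_conditionI:
  assumes *: "\<And>e. 0 < e \<Longrightarrow> e \<le> 1 \<Longrightarrow> \<exists>a\<in>A \<inter> ball \<xi> e. \<exists>b\<in>B \<inter> ball \<xi> e.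
    \<exists>u\<in>frechet_normal_cone A a. \<exists>v\<in>frechet_normal_cone B b.
      norm u + norm v \<ge> 1 / 2 \<and> norm (u + v) < e / 2"
  shows "normal_sum_condition A B \<xi>"
  unfolding normal_sum_condition_def
proof (intro allI impI)
  fix \<epsilon> :: real assume "\<epsilon> > 0"
  then have "0 < min \<epsilon> 1" "min \<epsilon> 1 \<le> 1"
    by auto
  then obtain a b u v where a: "a \<in> A \<inter> ball \<xi> (min \<epsilon> 1)" "u \<in> frechet_normal_cone A a"
    and b: "b \<in> B \<inter> ball \<xi> (min \<epsilon> 1)" "v \<in> frechet_normal_cone B b"
    and uv: "norm u + norm v \<ge> 1 / 2" "norm (u + v) < min \<epsilon> 1 / 2"
    using *[of "min \<epsilon> 1"] by blast
  define N where "N = norm u + norm v"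
  have N: "N > 0"
    using uv by (simp add: N_def)
  have "norm ((1 / N) *\<^sub>R u) + norm ((1 / N) *\<^sub>R v) = 1"
    using N by (simp add: N_def add_divide_distrib[symmetric])
  moreover have "norm ((1 / N) *\<^sub>R u + (1 / N) *\<^sub>R v) < \<epsilon>"
  proof -
    have "norm (u + v) < \<epsilon> * (1 / 2)"
      using uv by simp
    also have "\<dots> \<le> \<epsilon> * N"
      using uv(1) \<open>\<epsilon> > 0\<close> by (simp add: N_def)
    finally show ?thesis
      using N by (simp add: scaleR_add_right[symmetric] divide_less_eq)
  qed
  moreover have "(1 / N) *\<^sub>R u \<in> frechet_normal_cone A a" "(1 / N) *\<^sub>R v \<in> frechet_normal_cone B b"
    using a b N by (simp_all add: scaleR_in_frechet_normal_cone)
  ultimately show "\<exists>a \<in> A \<inter> ball \<xi> \<epsilon>. \<exists>b \<in> B \<inter> ball \<xi> \<epsilon>.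
      \<exists>a' \<in> frechet_normal_cone A a. \<exists>b' \<in> frechet_normal_cone B b.
      norm a' + norm b' = 1 \<and> norm (a' + b') < \<epsilon>"
    using a(1) b(1) by (meson Int_iff mem_ball min_less_iff_conj)
qed

lemma infdist_less_obtain:
  assumes "infdist x S < e" "S \<noteq> {}"
  obtains y where "y \<in> S" "dist x y < e"
  using assms cInf_lessD[of "dist x ` S" e] by (auto simp: infdist_notempty)

text \<open>Normals close to \<open>a'\<close> and \<open>- a'\<close> almost cancel and cannot both be small. Conversely, if \<open>u + v\<close> is small
  compared with \<open>|u| + |v|\<close>, then \<open>u\<close> and \<open>v\<close> have almost equal norms, and \<open>u / |u|\<close> serves as
  \<open>a'\<close>: it is itself normal to \<open>A\<close>, and \<open>v / |u|\<close> is a normal to \<open>B\<close> near its negative.\<close>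

lemma normal_distance_condition_iff_normal_sum_condition:
  "normal_distance_condition A B \<xi> \<longleftrightarrow> normal_sum_condition A B \<xi>"
proof
  assume L: "normal_distance_condition A B \<xi>"
  show "normal_sum_condition A B \<xi>"
  proof (rule normal_sum_conditionI)
    fix e :: real assume e: "0 < e" "e \<le> 1"
    then have "e / 4 > 0" by simp
    then obtain a b w where a: "a \<in> A \<inter> ball \<xi> (e / 4)" and b: "b \<in> B \<inter> ball \<xi> (e / 4)"
      and w: "norm w = 1" "infdist w (frechet_normal_cone A a) < e / 4"
        "infdist (- w) (frechet_normal_cone B b) < e / 4"
      using L unfolding normal_distance_condition_def by blast
    obtain u where u: "u \<in> frechet_normal_cone A a" "dist w u < e / 4"
      using infdist_less_obtain[OF w(2)] zero_in_frechet_normal_cone by blast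
    obtain v where v: "v \<in> frechet_normal_cone B b" "dist (- w) v < e / 4"
      using infdist_less_obtain[OF w(3)] zero_in_frechet_normal_cone by blast
    have "norm u + norm v \<ge> 1 / 2"
      using u(2) w(1) e norm_triangle_ineq2[of w u] norm_ge_zero[of v] unfolding dist_norm by linarith
    moreover have "u + v = - ((w - u) + (- w - v))"
      by simp
    then have "norm (u + v) < e / 2"
      using u v norm_triangle_ineq[of "w - u" "- w - v"] by (simp only: norm_minus_cancel dist_norm)
    moreover have a': "a \<in> A \<inter> ball \<xi> e" and b': "b \<in> B \<inter> ball \<xi> e"
      using a b e by auto
    ultimately show "\<exists>a\<in>A \<inter> ball \<xi> e. \<exists>b\<in>B \<inter> ball \<xi> e.
        \<exists>u\<in>frechet_normal_cone A a. \<exists>v\<in>frechet_normal_cone B b.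
        norm u + norm v \<ge> 1 / 2 \<and> norm (u + v) < e / 2"
      using a' b' u(1) v(1) by blast
  qed
next
  assume R: "normal_sum_condition A B \<xi>"
  show "normal_distance_condition A B \<xi>"
    unfolding normal_distance_condition_def
  proof (intro allI impI)
    fix \<epsilon> :: real assume \<epsilon>: "\<epsilon> > 0"
    define e where "e = min (\<epsilon> / 4) (1 / 2)"
    have e: "e > 0" "e \<le> \<epsilon> / 4" "e \<le> 1 / 2"
      using \<epsilon> by (auto simp: e_def)
    obtain a b u v where a: "a \<in> A \<inter> ball \<xi> e" "u \<in> frechet_normal_cone A a"
      and b: "b \<in> B \<inter> ball \<xi> e" "v \<in> frechet_normal_cone B b"
      and uv: "norm u + norm v = 1" "norm (u + v) < e"
      using R e(1) unfolding normal_sum_condition_def by blast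
    have u: "norm u \<ge> 1 / 4"
      using uv e norm_triangle_ineq2[of "u + v" u] norm_triangle_ineq4[of "u + v" u] by simp
    define w where "w = (1 / norm u) *\<^sub>R u"
    have "norm u > 0"
      using u by linarith
    then have pos: "1 / norm u > 0" and w: "norm w = 1"
      by (simp_all add: w_def)
    note w
    moreover have "w \<in> frechet_normal_cone A a"
      unfolding w_def using a pos by (intro scaleR_in_frechet_normal_cone)
    then have "infdist w (frechet_normal_cone A a) < \<epsilon>"
      using \<epsilon> by simp
    moreover have "infdist (- w) (frechet_normal_cone B b) < \<epsilon>"
    proof -
      have "infdist (- w) (frechet_normal_cone B b) \<le> dist (- w) ((1 / norm u) *\<^sub>R v)"
        using b pos by (intro infdist_le scaleR_in_frechet_normal_cone)
      also have "- w - (1 / norm u) *\<^sub>R v = (- (1 / norm u)) *\<^sub>R (u + v)"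
        by (simp add: w_def scaleR_add_right)
      then have "dist (- w) ((1 / norm u) *\<^sub>R v) = norm (u + v) / norm u"
        by (simp add: dist_norm)
      also have "\<dots> < \<epsilon>"
      proof -
        have "norm (u + v) < \<epsilon> * (1 / 4)"
          using uv e by simp
        also have "\<dots> \<le> \<epsilon> * norm u"
          using u \<epsilon> by simp
        finally show ?thesis
          using pos by (simp add: divide_less_eq)
      qed
      finally show ?thesis .
    qed
    moreover have "a \<in> A \<inter> ball \<xi> \<epsilon>" "b \<in> B \<inter> ball \<xi> \<epsilon>"
      using a b e by auto
    ultimately show "\<exists>a \<in> A \<inter> ball \<xi> \<epsilon>. \<exists>b \<in> B \<inter> ball \<xi> \<epsilon>. \<exists>a' :: 'a \<Rightarrow>\<^sub>L real.
        norm a' = 1 \<and> infdist a' (frechet_normal_cone A a) < \<epsilon> \<and>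
        infdist (- a') (frechet_normal_cone B b) < \<epsilon>"
      by blast
  qed
qed

lemma extremal_pair_imp_normal_sum_condition:
  fixes A B :: "'a::banach set"
  assumes asplund: "asplund_space TYPE('a)" and A: "closed A" and B: "closed B"
    and \<xi>: "\<xi> \<in> A \<inter> B" and ext: "extremal_pair A B"
  shows "normal_sum_condition A B \<xi>"
proof (rule normal_sum_conditionI)
  fix e :: real assume e: "0 < e" "e \<le> 1"
  \<comment> \<open>Passing to exact normals changes the functionals by at most \<open>6 * c\<close> each, so their sum has norm at
    most \<open>12 * c = e / 3\<close>, and each of them keeps norm at least \<open>1/3\<close>.\<close>
  define c where "c = e / 36"
  have c: "0 < c" "c \<le> 1" "c \<le> 1 / 36" "c < e / 2"
    using e by (auto simp: c_def)
  obtain a b w r where a: "a \<in> A" "dist a \<xi> < c" "approx_normal A a r c w"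
    and b: "b \<in> B" "dist b \<xi> < c" "approx_normal B b r c (- w)" and w: "norm w \<ge> 1 / 2" and r: "r > 0"
    using extremal_pair_approx_normals[OF asplund A B \<xi> ext c(1,2)] by metis
  obtain a' u where a': "a' \<in> A" "dist a' a \<le> c" "u \<in> frechet_normal_cone A a'" "norm (u - w) \<le> 6 * c"
    using approx_normal_imp_near_frechet_normal[OF asplund A a(1,3) c(1) r c(1)] by metis
  obtain b' v where b': "b' \<in> B" "dist b' b \<le> c" "v \<in> frechet_normal_cone B b'" "norm (v - (- w)) \<le> 6 * c"
    using approx_normal_imp_near_frechet_normal[OF asplund B b(1,3) c(1) r c(1)] by metis
  have "norm u \<ge> 1 / 2 - 6 * c" "norm v \<ge> 1 / 2 - 6 * c"
    using a'(4) b'(4) w norm_triangle_ineq2[of w u] norm_triangle_ineq2[of "- w" v]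
    by (simp_all add: norm_minus_commute)
  then have "norm u + norm v \<ge> 1 / 2"
    using c by linarith
  moreover have "u + v = (u - w) + (v - (- w))"
    by simp
  then have "norm (u + v) \<le> norm (u - w) + norm (v - (- w))"
    by (metis norm_triangle_ineq)
  then have "norm (u + v) \<le> 12 * c"
    using a'(4) b'(4) by linarith
  then have "norm (u + v) < e / 2"
    using e by (simp add: c_def)
  moreover have "a' \<in> A \<inter> ball \<xi> e" "b' \<in> B \<inter> ball \<xi> e"
    using a a' b b' c dist_triangle[of a' \<xi> a] dist_triangle[of b' \<xi> b] by (auto simp: dist_commute)
  ultimately show "\<exists>a\<in>A \<inter> ball \<xi> e. \<exists>b\<in>B \<inter> ball \<xi> e.
      \<exists>u\<in>frechet_normal_cone A a. \<exists>v\<in>frechet_normal_cone B b.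
      norm u + norm v \<ge> 1 / 2 \<and> norm (u + v) < e / 2"
    using a'(3) b'(3) by blast
qed

theorem corollary4:
  fixes A B :: "'a::banach set" and \<xi> :: 'a
  assumes "asplund_space TYPE('a)"
    and "closed A" and "closed B"
    and "\<xi> \<in> A \<inter> B"
  shows "(normal_distance_condition A B \<xi> \<longleftrightarrow> normal_sum_condition A B \<xi>) \<and>
    (extremal_pair A B \<longrightarrow> normal_distance_condition A B \<xi> \<and> normal_sum_condition A B \<xi>)"
  using extremal_pair_imp_normal_sum_condition[OF assms]
  by (simp add: normal_distance_condition_iff_normal_sum_condition)

end
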